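(* Let $G$ be a ribbon graph or a cellularly embedded graph, and let $k$ be a natural number. Then $$\Omega_k(G;w,x,y,z)=\Omega(G;(w-x-y-z),x,y,z,k),$$ where $\Omega_k(G;w,x,y,z):=\sum_{\phi\text{ a }k\text{-valuation of }G_m}w^{\mathrm{tot}(\phi)}x^{\mathrm{wh}(\phi)}y^{\mathrm{bl}(\phi)}z^{\mathrm{cr}(\phi)}$. In particular, $\Omega_k(G;w,x,y,z)$ is a polynomial in $k$.
   Context: **Ribbon graphs.** A ribbon graph $G=(V(G),E(G))$ is a surface with boundary, represented as the union of two sets of discs, a set $V(G)$ of vertices and a set $E(G)$ of edges, such that: (1) the vertices and edges intersect in disjoint line segments; (2) each such line segment lies on the boundary of precisely one vertex and precisely one edge; (3) every edge contains exactly two such line segments. Equivalence is homeomorphism (orientation preserving when orientable) mapping vertices to vertices and edges to edges. A cellularly embedded graph is identified with the ribbon graph given by its regular neighbourhood in the surface, and $\Omega(G)$ for such a graph means $\Omega$ of that ribbon graph. Let $e\in E(G)$. *Deletion:* $G\setminus e$ is obtained by removing the edge $e$. *Contraction:* if $u,v$ are the (not necessarily distinct) vertices incident with $e$, consider the boundary component(s) of $e\cup\{u,v\}$ as curves on $G$; for each curve attach a disc (a new vertex) by identifying its boundary with the curve, and then delete $e,u,v$; the result is $G/e$. *Partial Petrial:* $G^{\tau(e)}$ is obtained by detaching one end of $e$ from its incident vertex $v$, creating arcs $[a,b]$ on $v$ and $[a',b']$ on $e$ (so that $G$ is recovered by identifying $[a,b]$ with $[a',b']$), and reattaching by identifying $[a,b]$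 with $[b',a']$ (giving $e$ a half-twist). *Penrose-contraction:* $G\rightthreetimes e:=G^{\tau(e)}/e$. **Edge-point ribbon graphs.** An edge-point ribbon graph is an object obtained from a ribbon graph $(V,E)$ by contracting each edge (disc) in some (possibly empty) subset of $E$ to a point; the points so created are singular points and the images of the other edges are its edges. Equivalently, it is an edge 2-coloured ribbon graph in which dark grey edges represent those contracted to points and light grey edges are the edges of the edge-point ribbon graph (considered up to partial Petrials of dark grey edges). Ribbon graphs are the edge-point ribbon graphs with no singular points. Deletion, contraction and Penrose-contraction are inherited by performing the ribbon graph operations on light grey edges in the 2-coloured model. $G\odot e$ is obtained by contracting $e$ to a point (recolouring $e$ dark grey). **The polynomial $\Omega$.** $\Omega(G)=\Omega(G;w,x,y,z,t)\in\mathbb{Z}[w,x,y,z,t]$ is the polynomial of edge-point ribbon graphs defined by $\Omega(G)=w\,\Omega(G\odot e)+x\,\Omega(G/e)+y\,\Omega(G\setminus e)+z\,\Omega(G\rightthreetimes e)$ for any edge $e$, and $\Omega(G)=t^{\kappa(G)}$ if $G$ is edgeless, where $\kappa(G)$ is the number of connected components. **Medial graphs.** For a graph $G$ embedded in a surface, the medial graph $G_m$ is the 4-regular graph (possibly with free-loops, i.e. circular edges with no incident vertex) embedded in the surface obtained by placing a vertex on each edge of $G$, adding edges as curves following the face boundaries between these vertices, and, for each isolated vertex of $G$, adding a free-loop following the boundary of a neighbourhood of the vertex. For a ribbon graph $G$, equivalently: take one point on each edge of $G$ as a vertex of $G_m$; from it draw four non-intersecting curves on the edge to the four corners of the edge;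 connect these by following the boundary of $G$ around the vertices; add a free-loop around each isolated vertex. The canonical checkerboard colouring of $G_m$ colours faces containing a vertex of $G$ black and the others white. Thus at the vertex of $G_m$ on an edge $e$, the two half-edges going towards the same end of $e$ border a common black corner, and the two half-edges on the same side of $e$ border a common white corner. **$k$-valuations.** A $k$-valuation $\phi$ of $G_m$ is an edge $k$-colouring of $G_m$, i.e. a map from the edges of $G_m$ (including free-loops) to $\{1,\dots,k\}$, such that each vertex is incident to an even number (possibly zero) of edges (half-edges) of each colour. At each vertex exactly one of four configurations occurs: *total* (all four half-edges have one colour); or, with two distinct colours $i\ne j$: *white* (the two half-edges bordering each white corner have the same colour, one white corner having colour $i$ and the other $j$), *black* (the two half-edges bordering each black corner have the same colour, one black corner having colour $i$ and the other $j$), *crossing* (opposite half-edges have the same colour). $\mathrm{tot}(\phi),\mathrm{wh}(\phi),\mathrm{bl}(\phi),\mathrm{cr}(\phi)$ are the numbers of total, white, black, crossing vertices of $\phi$. *)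

theory Defs
  imports
    "HOL-Library.Poly_Mapping"
    "HOL-Library.FuncSet"
    "HOL-Library.Disjoint_Sets"
    "HOL-Computational_Algebra.Polynomial"
begin

section \<open>Ribbon graphs\<close>

text \<open>
  Ribbon graphs are encoded up to equivalence by their cell structure.  An edge \<open>e\<close> is a
  rectangle with corners \<open>(e, i, s)\<close>.  The two corners with the same \<open>i\<close> bound an \<open>end\<close> of the
  edge, i.e. one of the two line segments in which the edge disc meets the vertex discs; the two
  corners with the same \<open>s\<close> bound a \<open>side\<close> of the edge, i.e. one of the two segments of the
  edge disc that lie on the boundary of the surface.

  Removing all the edge ends from the boundary circles of the vertex discs leaves a collection
  of arcs, each joining two corners, together with the full circles that carry no edge end
  (the isolated vertices).  Every corner is an endpoint of exactly one arc.
  Conversely, any perfect matching of the corners arises: the circles alternating between arcs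
  and edge ends are the boundaries of the non-isolated vertex discs, which can be filled in
  uniquely.  So the set of edges, the matching and the number of isolated vertices determine the
  ribbon graph.  No orientation is chosen, so non-orientable ribbon graphs are included.
\<close>

type_synonym 'e corner = "'e \<times> bool \<times> bool"

record 'e ribbon_graph =
  edges :: "'e set"
  arcs :: "'e corner set set"
  isolated :: nat

definition corners_of :: "'e \<Rightarrow> 'e corner set" where
  "corners_of e = {e} \<times> UNIV"

definition corners :: "('e, 'b) ribbon_graph_scheme \<Rightarrow> 'e corner set" where
  "corners G = (\<Union>e\<in>edges G. corners_of e)"

definition ribbon_graph :: "('e, 'b) ribbon_graph_scheme \<Rightarrow> bool" where
  "ribbon_graph G \<longleftrightarrow>
     finite (edges G) \<and> partition_on (corners G) (arcs G) \<and> (\<forall>a\<in>arcs G. card a = 2)"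

definition edge_ends :: "'e \<Rightarrow> 'e corner set set" where
  "edge_ends e = {{(e, i, False), (e, i, True)} | i. True}"

definition edge_sides :: "'e \<Rightarrow> 'e corner set set" where
  "edge_sides e = {{(e, False, s), (e, True, s)} | s. True}"

text \<open>
  The connected components of the corner set \<open>C\<close> when the members of each block \<open>p \<in> P\<close>
  are joined to each other.
\<close>

definition components :: "'c set \<Rightarrow> 'c set set \<Rightarrow> 'c set set" where
  "components C P = C // ((\<Union>p\<in>P. p \<times> p)\<^sup>* \<inter> C \<times> C)"

text \<open>Edge discs are connected, arcs join discs, and every isolated vertex is a component.\<close>

definition kappa :: "('e, 'b) ribbon_graph_scheme \<Rightarrow> nat" where
  "kappa G = card (components (corners G) (arcs G \<union> corners_of ` edges G)) + isolated G"

text \<open>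
  Both deletion and contraction of \<open>e\<close> remove the edge and replace the vertices incident with it
  by discs bounded by certain curves: in \<open>G \<setminus> e\<close> these are the old vertex boundaries, which run
  along the arcs and, at \<open>e\<close>, along the ends of \<open>e\<close>; in \<open>G / e\<close> they are the boundary curves of
  the union of \<open>e\<close> with its incident vertices, which run along the arcs and, at \<open>e\<close>, along the
  sides of \<open>e\<close>.  With \<open>S\<close> the set of ends, respectively sides, of \<open>e\<close>, a component of the arcs
  together with \<open>S\<close> is either a path, which becomes a single arc between the two corners of
  other edges at which it stops, or a closed curve meeting only the edge \<open>e\<close>, which bounds a new
  isolated vertex.
\<close>

definition splice ::
    "('e, 'b) ribbon_graph_scheme \<Rightarrow> 'e \<Rightarrow> 'e corner set set \<Rightarrow> ('e, 'b) ribbon_graph_scheme" where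
  "splice G e S =
     (let K = components (corners G) (arcs G \<union> S) in
      G\<lparr>edges := edges G - {e},
        arcs := {c - corners_of e | c. c \<in> K \<and> \<not> c \<subseteq> corners_of e},
        isolated := isolated G + card {c \<in> K. c \<subseteq> corners_of e}\<rparr>)"

definition delete :: "('e, 'b) ribbon_graph_scheme \<Rightarrow> 'e \<Rightarrow> ('e, 'b) ribbon_graph_scheme" where
  "delete G e = splice G e (edge_ends e)"

definition contract :: "('e, 'b) ribbon_graph_scheme \<Rightarrow> 'e \<Rightarrow> ('e, 'b) ribbon_graph_scheme" where
  "contract G e = splice G e (edge_sides e)"

text \<open>
  The end \<open>i = True\<close> of \<open>e\<close> is detached and reattached with its two corners interchanged.
\<close>

definition half_twist :: "'e \<Rightarrow> 'e corner \<Rightarrow> 'e corner" where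
  "half_twist e = (\<lambda>(f, i, s). if f = e \<and> i then (f, i, \<not> s) else (f, i, s))"

definition partial_petrial ::
    "('e, 'b) ribbon_graph_scheme \<Rightarrow> 'e \<Rightarrow> ('e, 'b) ribbon_graph_scheme" where
  "partial_petrial G e = G\<lparr>arcs := (\<lambda>a. half_twist e ` a) ` arcs G\<rparr>"

definition penrose_contract ::
    "('e, 'b) ribbon_graph_scheme \<Rightarrow> 'e \<Rightarrow> ('e, 'b) ribbon_graph_scheme" where
  "penrose_contract G e = contract (partial_petrial G e) e"


section \<open>Edge-point ribbon graphs\<close>

text \<open>
  These are represented by the edge 2-coloured ribbon graphs, the dark edges being those that are
  contracted to points.  Two representatives that differ by partial Petrials of dark edges stand
  for the same edge-point ribbon graph; all operations below respect this.
  Since an edge disc and the point it is contracted to are both connected, \<open>kappa\<close> of a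
  representative is the number of components of the edge-point ribbon graph.
\<close>

record 'e ep_ribbon_graph = "'e ribbon_graph" +
  dark :: "'e set"

definition ep_ribbon_graph :: "'e ep_ribbon_graph \<Rightarrow> bool" where
  "ep_ribbon_graph G \<longleftrightarrow> ribbon_graph G \<and> dark G \<subseteq> edges G"

definition light :: "'e ep_ribbon_graph \<Rightarrow> 'e set" where
  "light G = edges G - dark G"

definition contract_to_point :: "'e ep_ribbon_graph \<Rightarrow> 'e \<Rightarrow> 'e ep_ribbon_graph" where
  "contract_to_point G e = G\<lparr>dark := insert e (dark G)\<rparr>"

definition ep_of_ribbon_graph :: "'e ribbon_graph \<Rightarrow> 'e ep_ribbon_graph" where
  "ep_of_ribbon_graph G =
     \<lparr>edges = edges G, arcs = arcs G, isolated = isolated G, dark = {}\<rparr>"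


section \<open>The polynomial Omega\<close>

datatype indet = Iw | Ix | Iy | Iz | It

type_synonym wxyzt_poly = "(indet \<Rightarrow>\<^sub>0 nat) \<Rightarrow>\<^sub>0 int"

definition Var :: "indet \<Rightarrow> wxyzt_poly" where
  "Var v = Poly_Mapping.single (Poly_Mapping.single v 1) 1"

definition eval_poly :: "(indet \<Rightarrow> 'a::comm_ring_1) \<Rightarrow> wxyzt_poly \<Rightarrow> 'a" where
  "eval_poly a p =
     (\<Sum>m\<in>Poly_Mapping.keys p. of_int (Poly_Mapping.lookup p m) *
        (\<Prod>v\<in>Poly_Mapping.keys m. a v ^ Poly_Mapping.lookup m v))"

definition is_Omega :: "('e ep_ribbon_graph \<Rightarrow> wxyzt_poly) \<Rightarrow> bool" where
  "is_Omega F \<longleftrightarrow>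
     (\<forall>G. ep_ribbon_graph G \<longrightarrow> light G = {} \<longrightarrow> F G = Var It ^ kappa G) \<and>
     (\<forall>G. ep_ribbon_graph G \<longrightarrow> (\<forall>e\<in>light G.
        F G = Var Iw * F (contract_to_point G e) + Var Ix * F (contract G e)
            + Var Iy * F (delete G e) + Var Iz * F (penrose_contract G e)))"

text \<open>The two clauses determine the value on every edge-point ribbon graph.\<close>

definition Omega :: "'e ep_ribbon_graph \<Rightarrow> wxyzt_poly" where
  "Omega = (SOME F. is_Omega F)"

definition Omega_at ::
    "'e ep_ribbon_graph \<Rightarrow> 'a::comm_ring_1 \<Rightarrow> 'a \<Rightarrow> 'a \<Rightarrow> 'a \<Rightarrow> 'a \<Rightarrow> 'a" where
  "Omega_at G w x y z t =
     eval_poly (case_indet w x y z t) (Omega G)"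


section \<open>Medial graphs and valuations\<close>

text \<open>
  The medial graph has the edges of \<open>G\<close> as vertices.  The four half-edges at \<open>e\<close> run to the four
  corners of \<open>e\<close> and are identified with them; following the boundary of \<open>G\<close> around the vertices
  they are joined up along the arcs.  Each isolated vertex gives a free-loop.
\<close>

datatype 'e medial_edge = Arc "'e corner set" | Free_loop nat

definition medial_edges :: "'e ribbon_graph \<Rightarrow> 'e medial_edge set" where
  "medial_edges G = Arc ` arcs G \<union> Free_loop ` {..<isolated G}"

definition half_edge_colour ::
    "'e ribbon_graph \<Rightarrow> ('e medial_edge \<Rightarrow> nat) \<Rightarrow> 'e corner \<Rightarrow> nat" where
  "half_edge_colour G \<phi> c = \<phi> (Arc (THE a. a \<in> arcs G \<and> c \<in> a))"

definition valuations :: "nat \<Rightarrow> 'e ribbon_graph \<Rightarrow> ('e medial_edge \<Rightarrow> nat) set" where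
  "valuations k G =
     {\<phi> \<in> medial_edges G \<rightarrow>\<^sub>E {1..k}.
        \<forall>e\<in>edges G. \<forall>i\<in>{1..k}. even (card {c \<in> corners_of e. half_edge_colour G \<phi> c = i})}"

text \<open>
  The half-edges at the two corners of an edge end border a common black corner, those at the two
  corners of a side border a common white corner.
\<close>

definition total_at :: "'e ribbon_graph \<Rightarrow> ('e medial_edge \<Rightarrow> nat) \<Rightarrow> 'e \<Rightarrow> bool" where
  "total_at G \<phi> e \<longleftrightarrow> (\<exists>i. \<forall>c\<in>corners_of e. half_edge_colour G \<phi> c = i)"

definition white_at :: "'e ribbon_graph \<Rightarrow> ('e medial_edge \<Rightarrow> nat) \<Rightarrow> 'e \<Rightarrow> bool" where
  "white_at G \<phi> e \<longleftrightarrow> (\<exists>i j. i \<noteq> j \<and>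
     half_edge_colour G \<phi> (e, False, False) = i \<and> half_edge_colour G \<phi> (e, True, False) = i \<and>
     half_edge_colour G \<phi> (e, False, True) = j \<and> half_edge_colour G \<phi> (e, True, True) = j)"

definition black_at :: "'e ribbon_graph \<Rightarrow> ('e medial_edge \<Rightarrow> nat) \<Rightarrow> 'e \<Rightarrow> bool" where
  "black_at G \<phi> e \<longleftrightarrow> (\<exists>i j. i \<noteq> j \<and>
     half_edge_colour G \<phi> (e, False, False) = i \<and> half_edge_colour G \<phi> (e, False, True) = i \<and>
     half_edge_colour G \<phi> (e, True, False) = j \<and> half_edge_colour G \<phi> (e, True, True) = j)"

definition crossing_at :: "'e ribbon_graph \<Rightarrow> ('e medial_edge \<Rightarrow> nat) \<Rightarrow> 'e \<Rightarrow> bool" where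
  "crossing_at G \<phi> e \<longleftrightarrow> (\<exists>i j. i \<noteq> j \<and>
     half_edge_colour G \<phi> (e, False, False) = i \<and> half_edge_colour G \<phi> (e, True, True) = i \<and>
     half_edge_colour G \<phi> (e, False, True) = j \<and> half_edge_colour G \<phi> (e, True, False) = j)"

definition Omega_k ::
    "nat \<Rightarrow> 'e ribbon_graph \<Rightarrow> 'a::comm_ring_1 \<Rightarrow> 'a \<Rightarrow> 'a \<Rightarrow> 'a \<Rightarrow> 'a" where
  "Omega_k k G w x y z =
     (\<Sum>\<phi>\<in>valuations k G.
        w ^ card {e \<in> edges G. total_at G \<phi> e} *
        x ^ card {e \<in> edges G. white_at G \<phi> e} *
        y ^ card {e \<in> edges G. black_at G \<phi> e} *
        z ^ card {e \<in> edges G. crossing_at G \<phi> e})"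

end

theory Submission
  imports Defs
begin

text \<open>
  Both sides of the identity are one and the same state sum.  A state chooses at every edge one of
  contraction to a point, contraction, deletion and Penrose-contraction.  These join the four
  corners of the edge all together, along its sides, along its ends, or along its diagonals.  With
  the arcs and the isolated vertices, the joined corners form a system of curves, some touching at
  points; the state contributes the product of the weights of its choices times \<open>t\<close> to the number
  of components of this system.

  \<^item> Let \<open>t = k\<close>.  Then \<open>t\<close> to the number of components counts the ways to give each component one
    of \<open>k\<close> colours.  Exchanging the sum over states with the sum over such colourings, a colouring
    of the medial graph receives, at each edge, the sum of the weights of all choices that join
    only corners of equal colour.  With the weights \<open>w - x - y - z\<close>, \<open>x\<close>, \<open>y\<close>, \<open>z\<close> this is \<open>w\<close> at a
    total vertex, \<open>x\<close>, \<open>y\<close>, \<open>z\<close> at a white, black, crossing vertex, and \<open>0\<close> if the colours at the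
    vertex do not occur evenly.  What is left is the sum over \<open>k\<close>-valuations
    (\<open>Omega_k_eq_state_sum\<close>).

  \<^item> Grouping the states by their choice at a fixed edge shows that the state sum obeys the recursion
    defining \<open>Omega\<close> (\<open>state_sum_rec\<close>).  The topological content is that joining the corners of one
    edge first and cutting that edge out does not change the number of components
    (\<open>card_components_splice\<close>).  In particular a polynomial satisfying the recursion exists, for every
    order of the edges, and by induction on the number of light edges it is unique
    (\<open>is_Omega_Omega\<close>, \<open>eval_Omega\<close>).

  Neither the states nor their numbers of components involve \<open>k\<close>, so each state contributes a
  coefficient free of \<open>k\<close> times a fixed power of \<open>k\<close>, whence the polynomial dependence on \<open>k\<close>.
\<close>

section \<open>Components of a family of blocks\<close>

text \<open>
  The equivalence relation whose classes in \<open>C\<close> are \<open>components C P\<close>; keeping the ambient set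
  \<open>C\<close> out of it makes it monotone in \<open>P\<close>, and independent of removing points from \<open>C\<close>.
\<close>

definition joined :: "'c set set \<Rightarrow> 'c rel" where
  "joined P = (\<Union>p\<in>P. p \<times> p)\<^sup>*"

definition component_of :: "'c set \<Rightarrow> 'c set set \<Rightarrow> 'c \<Rightarrow> 'c set" where
  "component_of C P x = {y \<in> C. (x, y) \<in> joined P}"

lemma joined_refl: "(x, x) \<in> joined P"
  by (simp add: joined_def)

lemma joined_block: "p \<in> P \<Longrightarrow> x \<in> p \<Longrightarrow> y \<in> p \<Longrightarrow> (x, y) \<in> joined P"
  unfolding joined_def by blast

lemma joined_trans: "(x, y) \<in> joined P \<Longrightarrow> (y, z) \<in> joined P \<Longrightarrow> (x, z) \<in> joined P"
  unfolding joined_def by (rule rtrancl_trans)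

lemma joined_sym: "(x, y) \<in> joined P \<Longrightarrow> (y, x) \<in> joined P"
proof -
  have "sym (joined P)"
    unfolding joined_def by (rule sym_rtrancl) (auto simp: sym_def)
  then show "(x, y) \<in> joined P \<Longrightarrow> (y, x) \<in> joined P"
    by (auto dest: symD)
qed

lemma joined_mono: "P \<subseteq> Q \<Longrightarrow> joined P \<subseteq> joined Q"
  unfolding joined_def by (rule rtrancl_mono) blast

lemma joined_induct [consumes 1, case_names refl step]:
  assumes "(x, y) \<in> joined P"
    and "R x"
    and "\<And>u v p. (x, u) \<in> joined P \<Longrightarrow> p \<in> P \<Longrightarrow> u \<in> p \<Longrightarrow> v \<in> p \<Longrightarrow> R u \<Longrightarrow> R v"
  shows "R y"
  using assms(1) unfolding joined_def
proof (induction rule: rtrancl_induct)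
  case base
  then show ?case by (fact assms(2))
next
  case (step u v)
  then obtain p where "p \<in> P" "u \<in> p" "v \<in> p" by blast
  with step show ?case using assms(3)[of u p v] by (simp add: joined_def)
qed

lemma joined_constant:
  assumes "(x, y) \<in> joined P" and "\<And>p u v. p \<in> P \<Longrightarrow> u \<in> p \<Longrightarrow> v \<in> p \<Longrightarrow> f u = f v"
  shows "f x = f y"
  using assms(1) by (induction rule: joined_induct) (auto dest: assms(2))

lemma components_conv: "components C P = component_of C P ` C"
  unfolding components_def component_of_def quotient_def joined_def[symmetric]
  by (auto simp: Image_def)

lemma component_of_in: "x \<in> C \<Longrightarrow> component_of C P x \<in> components C P"
  by (simp add: components_conv)

lemma self_in_component_of: "x \<in> C \<Longrightarrow> x \<in> component_of C P x"
  by (simp add: component_of_def joined_refl)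

lemma component_of_cong:
  "(x, y) \<in> joined P \<Longrightarrow> component_of C P x = component_of C P y"
  unfolding component_of_def using joined_trans joined_sym by fast

lemma component_of_eqI: "c \<in> components C P \<Longrightarrow> x \<in> c \<Longrightarrow> c = component_of C P x"
proof -
  assume "c \<in> components C P" "x \<in> c"
  then obtain y where y: "c = component_of C P y" "(y, x) \<in> joined P"
    by (auto simp: components_conv component_of_def)
  then show ?thesis using component_of_cong[OF y(2)] by simp
qed

lemma component_subset: "c \<in> components C P \<Longrightarrow> c \<subseteq> C"
  by (auto simp: components_conv component_of_def)

lemma finite_components: "finite C \<Longrightarrow> finite (components C P)"
  by (simp add: components_conv)

lemma partition_on_components: "partition_on C (components C P)"
proof (rule partition_onI)
  show "\<Union> (components C P) = C"
    by (auto simp: components_conv component_of_def joined_refl)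
  show "disjnt c d" if "c \<in> components C P" "d \<in> components C P" "c \<noteq> d" for c d
    using component_of_eqI[OF that(1)] component_of_eqI[OF that(2)] that(3)
    unfolding disjnt_iff by blast
  show "{} \<notin> components C P"
    by (auto simp: components_conv component_of_def joined_refl)
qed

lemma components_partition_on:
  assumes "partition_on C P"
  shows "components C P = P"
proof -
  have *: "component_of C P x = p" if p: "p \<in> P" "x \<in> p" for p x
  proof
    show "p \<subseteq> component_of C P x"
      using p assms joined_block[OF p] by (auto simp: component_of_def partition_on_def)
    show "component_of C P x \<subseteq> p"
    proof
      fix y assume "y \<in> component_of C P x"
      then have "(x, y) \<in> joined P" by (simp add: component_of_def)
      then show "y \<in> p"
        by (induction rule: joined_induct)
          (use p assms in \<open>auto simp: partition_on_def disjoint_def\<close>)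
    qed
  qed
  show ?thesis
  proof
    show "components C P \<subseteq> P"
      using assms * by (auto simp: components_conv partition_on_def)
    show "P \<subseteq> components C P"
    proof
      fix p assume p: "p \<in> P"
      then obtain x where "x \<in> p" "x \<in> C"
        using assms by (metis UnionI ex_in_conv partition_on_def)
      with p show "p \<in> components C P"
        using *[OF p] component_of_in by metis
    qed
  qed
qed

text \<open>
  A map that is constant on every block is constant on every component, hence is the same thing as
  an arbitrary map on the set of components.
\<close>

lemma card_colourings:
  assumes "finite C" and "\<And>p. p \<in> P \<Longrightarrow> p \<subseteq> C" and "finite T"
  shows "card {f \<in> C \<rightarrow>\<^sub>E T. \<forall>p\<in>P. \<forall>x\<in>p. \<forall>y\<in>p. f x = f y} = card T ^ card (components C P)"
proof -
  let ?F = "{f \<in> C \<rightarrow>\<^sub>E T. \<forall>p\<in>P. \<forall>x\<in>p. \<forall>y\<in>p. f x = f y}"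
  let ?K = "components C P"
  define up where "up g = (\<lambda>x\<in>C. g (component_of C P x))" for g :: "'a set \<Rightarrow> 'b"
  define pick where "pick c = (SOME x. x \<in> c)" for c :: "'a set"
  define down where "down f = (\<lambda>c\<in>?K. f (pick c))" for f :: "'a \<Rightarrow> 'b"
  have pick: "pick c \<in> c" if "c \<in> ?K" for c
  proof -
    have "c \<noteq> {}" using that partition_onD3[OF partition_on_components] by metis
    then show ?thesis unfolding pick_def by (rule some_in_eq[THEN iffD2])
  qed
  have pickC: "pick c \<in> C" if "c \<in> ?K" for c
    using pick[OF that] component_subset[OF that] by blast
  have comp_pick: "component_of C P (pick c) = c" if "c \<in> ?K" for c
    using component_of_eqI[OF that pick[OF that]] by (rule sym)
  have up_const: "up g x = up g y" if "p \<in> P" "x \<in> p" "y \<in> p" for g p x y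
  proof -
    have "x \<in> C" "y \<in> C" using that assms(2) by auto
    moreover have "component_of C P x = component_of C P y"
      using that by (intro component_of_cong joined_block)
    ultimately show ?thesis by (simp add: up_def)
  qed
  have "bij_betw up (?K \<rightarrow>\<^sub>E T) ?F"
  proof (rule bij_betw_byWitness[where f' = down])
    show "\<forall>g\<in>?K \<rightarrow>\<^sub>E T. down (up g) = g"
    proof (intro ballI ext)
      fix g c assume g: "g \<in> ?K \<rightarrow>\<^sub>E T"
      show "down (up g) c = g c"
        using PiE_arb[OF g, of c]
        by (cases "c \<in> ?K") (simp_all add: down_def up_def pickC comp_pick)
    qed
    show "\<forall>f\<in>?F. up (down f) = f"
    proof (intro ballI ext)
      fix f x assume f: "f \<in> ?F"
      show "up (down f) x = f x"
      proof (cases "x \<in> C")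
        case True
        let ?y = "pick (component_of C P x)"
        have "(x, ?y) \<in> joined P"
          using pick[OF component_of_in[OF True]] by (simp add: component_of_def)
        then have "f x = f ?y" by (rule joined_constant) (use f in blast)
        then show ?thesis using True by (simp add: component_of_in up_def down_def)
      next
        case False
        then show ?thesis using f by (simp add: PiE_arb[of f C "\<lambda>_. T"] up_def)
      qed
    qed
    show "up ` (?K \<rightarrow>\<^sub>E T) \<subseteq> ?F"
    proof (rule image_subsetI)
      fix g assume g: "g \<in> ?K \<rightarrow>\<^sub>E T"
      have "up g \<in> C \<rightarrow>\<^sub>E T"
        unfolding up_def by (intro restrict_PiE_iff[THEN iffD2] ballI PiE_mem[OF g] component_of_in)
      then show "up g \<in> ?F" by (intro CollectI conjI ballI up_const)
    qed
    show "down ` ?F \<subseteq> ?K \<rightarrow>\<^sub>E T"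
    proof (rule image_subsetI)
      fix f assume "f \<in> ?F"
      then have f: "f \<in> C \<rightarrow>\<^sub>E T" by simp
      show "down f \<in> ?K \<rightarrow>\<^sub>E T"
        unfolding down_def by (intro restrict_PiE_iff[THEN iffD2] ballI PiE_mem[OF f] pickC)
    qed
  qed
  then have "card ?F = card (?K \<rightarrow>\<^sub>E T)" by (simp add: bij_betw_same_card)
  also have "\<dots> = card T ^ card ?K" by (simp add: card_funcsetE finite_components assms)
  finally show ?thesis .
qed

text \<open>
  If two families join the points of \<open>D\<close> in the same way, then intersecting with \<open>D\<close> is a bijection
  from the components that meet \<open>D\<close> onto the components within \<open>D\<close>.
\<close>

lemma card_components_subset:
  assumes "finite C" "D \<subseteq> C"
    and "\<And>x y. x \<in> D \<Longrightarrow> y \<in> D \<Longrightarrow> (x, y) \<in> joined Q \<longleftrightarrow> (x, y) \<in> joined P"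
  shows "card (components D Q) = card {c \<in> components C P. \<not> c \<subseteq> C - D}"
proof -
  have restr: "component_of C P x \<inter> D = component_of D Q x" if "x \<in> D" for x
    using that assms(2,3) by (auto simp: component_of_def)
  have eq: "{c \<in> components C P. \<not> c \<subseteq> C - D} = component_of C P ` D" (is "?L = ?R")
  proof
    show "?L \<subseteq> ?R" using component_of_eqI component_subset by fast
    show "?R \<subseteq> ?L"
    proof (rule image_subsetI)
      fix x assume "x \<in> D"
      then show "component_of C P x \<in> ?L"
        using assms(2) component_of_in[of x C P] self_in_component_of[of x C P] by auto
    qed
  qed
  have "inj_on (\<lambda>c. c \<inter> D) (component_of C P ` D)"
  proof (rule inj_onI, clarify)
    fix x y assume xy: "x \<in> D" "y \<in> D" "component_of C P x \<inter> D = component_of C P y \<inter> D"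
    then have "y \<in> component_of C P x"
      using self_in_component_of[of y C P] assms(2) by blast
    then show "component_of C P x = component_of C P y"
      by (intro component_of_cong) (simp add: component_of_def)
  qed
  moreover have "(\<lambda>c. c \<inter> D) ` component_of C P ` D = components D Q"
    using restr by (simp add: components_conv image_image)
  ultimately show ?thesis unfolding eq by (metis card_image)
qed

text \<open>
  The components can be computed in two stages, which is what makes the order of the operations on
  different edges irrelevant.  The blocks \<open>P\<close> are joined up first, and then the part \<open>E\<close>, untouched
  by the blocks \<open>R\<close> still to come, is discarded.  A component of the first stage that is swallowed by
  \<open>E\<close> is final and must be counted at once; any other one leaves a trace outside \<open>E\<close>, through which
  all its later connections run.
\<close>

lemma card_components_splice:
  assumes "finite C" and P: "\<And>p. p \<in> P \<Longrightarrow> p \<subseteq> C" and R: "\<And>p. p \<in> R \<Longrightarrow> p \<subseteq> C - E"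
  defines "K \<equiv> components C P"
  shows "card (components C (P \<union> R)) =
    card (components (C - E) ({c - E | c. c \<in> K \<and> \<not> c \<subseteq> E} \<union> R)) + card {c \<in> K. c \<subseteq> E}"
proof -
  define K' where "K' = {c - E | c. c \<in> K \<and> \<not> c \<subseteq> E}"
  have K'I: "\<exists>c\<in>K'. x \<in> c \<and> y \<in> c" if "x \<in> C - E" "y \<in> C - E" "(x, y) \<in> joined P" for x y
  proof -
    have "component_of C P x - E \<in> K'"
      using that component_of_in[of x C P] self_in_component_of[of x C P]
      unfolding K'_def K_def by (intro CollectI exI[of _ "component_of C P x"]) auto
    moreover have "x \<in> component_of C P x - E" "y \<in> component_of C P x - E"
      using that by (auto simp: component_of_def joined_refl)
    ultimately show ?thesis by (intro bexI[of _ "component_of C P x - E"] conjI)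
  qed
  \<comment> \<open>On a path from \<open>x\<close>, the last point reached through a block of \<open>R\<close>, or else \<open>x\<close> itself,
    serves as \<open>u\<close>; from there on only blocks of \<open>P\<close> are used.\<close>
  have fwd: "\<exists>u\<in>C - E. (x, u) \<in> joined (K' \<union> R) \<and> (u, y) \<in> joined P"
    if "(x, y) \<in> joined (P \<union> R)" "x \<in> C - E" for x y
    using that
  proof (induction rule: joined_induct)
    case refl
    then show ?case using joined_refl by fast
  next
    case (step z z' p)
    then obtain u where u: "u \<in> C - E" "(x, u) \<in> joined (K' \<union> R)" "(u, z) \<in> joined P" by auto
    show ?case
    proof (cases "p \<in> P")
      case True
      then show ?thesis using u step joined_block joined_trans by metis
    next
      case False
      then have p: "p \<in> R" using step by auto
      then have z: "z \<in> C - E" "z' \<in> C - E" using R step by auto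
      then obtain c where "c \<in> K'" "u \<in> c" "z \<in> c" using K'I u by blast
      then have "(u, z) \<in> joined (K' \<union> R)" by (intro joined_block[of c]) auto
      moreover have "(z, z') \<in> joined (K' \<union> R)" using p step by (intro joined_block[of p]) auto
      ultimately have "(x, z') \<in> joined (K' \<union> R)" using u joined_trans by metis
      then show ?thesis using z joined_refl by fast
    qed
  qed
  have iff: "(x, y) \<in> joined (K' \<union> R) \<longleftrightarrow> (x, y) \<in> joined (P \<union> R)"
    if xy: "x \<in> C - E" "y \<in> C - E" for x y
  proof
    assume "(x, y) \<in> joined (K' \<union> R)"
    then show "(x, y) \<in> joined (P \<union> R)"
    proof (induction rule: joined_induct)
      case refl
      then show ?case by (rule joined_refl)
    next
      case (step u v p)
      have "(u, v) \<in> joined (P \<union> R)"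
      proof (cases "p \<in> R")
        case True
        then show ?thesis using step by (intro joined_block[of p]) auto
      next
        case False
        then obtain c where c: "c \<in> K" "u \<in> c" "v \<in> c" using step by (auto simp: K'_def)
        then have "v \<in> component_of C P u" using component_of_eqI[of c C P u] by (simp add: K_def)
        then have "(u, v) \<in> joined P" by (simp add: component_of_def)
        then show ?thesis using joined_mono[of P "P \<union> R"] by auto
      qed
      with step show ?case using joined_trans by metis
    qed
  next
    assume "(x, y) \<in> joined (P \<union> R)"
    then obtain u where u: "u \<in> C - E" "(x, u) \<in> joined (K' \<union> R)" "(u, y) \<in> joined P"
      using fwd xy by blast
    then obtain c where "c \<in> K'" "u \<in> c" "y \<in> c" using K'I xy by blast
    then have "(u, y) \<in> joined (K' \<union> R)" by (intro joined_block[of c]) auto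
    with u show "(x, y) \<in> joined (K' \<union> R)" using joined_trans by metis
  qed
  have closed: "component_of C (P \<union> R) x = component_of C P x"
    if "x \<in> C" "component_of C P x \<subseteq> E" for x
  proof
    show "component_of C P x \<subseteq> component_of C (P \<union> R) x"
      using joined_mono[of P "P \<union> R"] by (auto simp: component_of_def)
    show "component_of C (P \<union> R) x \<subseteq> component_of C P x"
    proof
      fix y assume "y \<in> component_of C (P \<union> R) x"
      then have "(x, y) \<in> joined (P \<union> R)" by (simp add: component_of_def)
      then show "y \<in> component_of C P x"
      proof (induction rule: joined_induct)
        case refl
        then show ?case using that self_in_component_of by fast
      next
        case (step u v p)
        then have "p \<in> P" using that R by blast
        with step have "(x, v) \<in> joined P" "v \<in> C"
          using P[of p] joined_trans[of x u P v] joined_block[of p P u v]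
          by (auto simp: component_of_def)
        then show ?case by (simp add: component_of_def)
      qed
    qed
  qed
  have inner: "{c \<in> components C (P \<union> R). c \<subseteq> E} = {c \<in> K. c \<subseteq> E}"
  proof (intro equalityI subsetI; clarsimp)
    fix c assume c: "c \<in> components C (P \<union> R)" "c \<subseteq> E"
    then obtain x where x: "x \<in> C" "c = component_of C (P \<union> R) x"
      by (auto simp: components_conv)
    moreover have "component_of C P x \<subseteq> component_of C (P \<union> R) x"
      using joined_mono[of P "P \<union> R"] by (auto simp: component_of_def)
    ultimately have "component_of C P x = c" using closed c by auto
    then show "c \<in> K" using x component_of_in K_def by metis
  next
    fix c assume "c \<in> K" "c \<subseteq> E"
    then show "c \<in> components C (P \<union> R)"
      using closed component_of_in unfolding K_def components_conv by fastforce
  qed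
  let ?A = "components C (P \<union> R)"
  have "card ?A = card {c \<in> ?A. \<not> c \<subseteq> E} + card {c \<in> ?A. c \<subseteq> E}"
    using assms(1) by (subst card_Un_disjoint[symmetric]) (auto intro!: arg_cong[of _ _ card] simp: finite_components)
  also have "{c \<in> ?A. \<not> c \<subseteq> E} = {c \<in> ?A. \<not> c \<subseteq> C - (C - E)}"
    using component_subset by fast
  also have "card \<dots> = card (components (C - E) (K' \<union> R))"
    using assms(1) iff by (intro card_components_subset[symmetric]) auto
  finally show ?thesis unfolding inner K'_def .
qed

lemma card_components_image:
  assumes "bij h"
  shows "card (components (h ` C) ((`) h ` P)) = card (components C P)"
proof -
  have fwd: "(g x, g y) \<in> joined ((`) g ` Q)" if "(x, y) \<in> joined Q" for g Q x y
    using that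
  proof (induction rule: joined_induct)
    case refl
    then show ?case by (rule joined_refl)
  next
    case (step u v p)
    then have "(g u, g v) \<in> joined ((`) g ` Q)" by (intro joined_block[of "g ` p"]) auto
    with step show ?case using joined_trans by metis
  qed
  have iff: "(h x, h y) \<in> joined ((`) h ` P) \<longleftrightarrow> (x, y) \<in> joined P" for x y
  proof
    have inj: "inj h" using assms by (rule bij_is_inj)
    have "(`) (inv h) ` (`) h ` P = P" using image_inv_f_f[OF inj] by (simp add: image_image)
    then show "(x, y) \<in> joined P" if "(h x, h y) \<in> joined ((`) h ` P)"
      using fwd[OF that, of "inv h"] by (simp add: inv_f_f[OF inj])
  qed (rule fwd)
  have "component_of (h ` C) ((`) h ` P) (h x) = h ` component_of C P x" for x
    using iff by (auto simp: component_of_def)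
  then have "components (h ` C) ((`) h ` P) = (`) h ` components C P"
    by (auto simp: components_conv image_image)
  moreover have "inj_on ((`) h) (components C P)"
    using assms by (meson bij_is_inj inj_image_eq_iff inj_onI)
  ultimately show ?thesis by (simp add: card_image)
qed

lemma card_2_obtain_other:
  assumes "card A = 2" "a \<in> A"
  obtains a' where "a' \<noteq> a" "A = {a, a'}"
proof -
  obtain x y where "A = {x, y}" "x \<noteq> y" using assms(1) by (auto simp: card_2_iff)
  then show ?thesis using assms(2) that[of x] that[of y] by (auto simp: insert_commute)
qed

text \<open>
  Joining the ends of paths gives paths and closed curves.  Here \<open>X\<close> is the set of points already
  passed through, so that \<open>card (c - X) = 2\<close> says that \<open>c\<close> is a path with two free ends, while
  \<open>c \<subseteq> X\<close> says that it has closed up.  Joining two free ends \<open>a\<close>, \<open>b\<close> either merges two paths into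
  one or closes up a single path.
\<close>

lemma card_component_diff_join_pair:
  assumes P: "\<And>c. c \<in> components C P \<Longrightarrow> card (c - X) = 2 \<or> c \<subseteq> X"
    and ab: "a \<in> C - X" "b \<in> C - X" "a \<noteq> b"
    and c: "c \<in> components C (insert {a, b} P)"
  shows "card (c - (X \<union> {a, b})) = 2 \<or> c \<subseteq> X \<union> {a, b}"
proof -
  let ?P' = "insert {a, b} P"
  have mono: "joined P \<subseteq> joined ?P'" by (rule joined_mono) auto
  have ab': "(a, b) \<in> joined ?P'" by (rule joined_block[of "{a, b}"]) auto
  have split: "(x, y) \<in> joined P \<or>
      ((x, a) \<in> joined P \<or> (x, b) \<in> joined P) \<and> ((a, y) \<in> joined P \<or> (b, y) \<in> joined P)"
    if "(x, y) \<in> joined ?P'" for x y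
    using that
  proof (induction rule: joined_induct)
    case refl
    then show ?case by (simp add: joined_refl)
  next
    case (step u v p)
    show ?case
    proof (cases "p \<in> P")
      case True
      then have "(u, v) \<in> joined P" using step by (intro joined_block[of p])
      then show ?thesis using step.IH joined_trans[of _ u P v] by metis
    next
      case False
      then have "u \<in> {a, b}" "v \<in> {a, b}" using step by auto
      then show ?thesis using step.IH joined_refl[of a P] joined_refl[of b P] by auto
    qed
  qed
  obtain x where x: "x \<in> C" "c = component_of C ?P' x" using c by (auto simp: components_conv)
  let ?A = "component_of C P a" and ?B = "component_of C P b"
  have AB: "a \<in> ?A" "b \<in> ?B" "?A \<in> components C P" "?B \<in> components C P"
    using ab by (auto intro: self_in_component_of component_of_in)
  then have cards: "card (?A - X) = 2" "card (?B - X) = 2" using P ab by auto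
  show ?thesis
  proof (cases "(x, a) \<in> joined P \<or> (x, b) \<in> joined P")
    case True
    then have "c = component_of C ?P' a"
      using x mono component_of_cong[of x a ?P' C] component_of_cong[of x b ?P' C]
        component_of_cong[OF ab', of C] by auto
    also have "\<dots> = ?A \<union> ?B"
      using split[of a] mono ab' joined_trans[of a b ?P'] joined_refl[of a P]
      by (fastforce simp: component_of_def)
    finally have cAB: "c = ?A \<union> ?B" .
    show ?thesis
    proof (cases "?A = ?B")
      case True
      then have ab_in: "a \<in> ?A - X" "b \<in> ?A - X" using AB ab by auto
      obtain a' where "?A - X = {a, a'}" using card_2_obtain_other[OF cards(1) ab_in(1)] .
      then have "?A - X = {a, b}" using ab_in ab by auto
      then show ?thesis using cAB True by auto
    next
      case False
      then have dis: "?A \<inter> ?B = {}"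
        using AB partition_on_components[of C P] by (auto simp: partition_on_def disjoint_def)
      have "a \<in> ?A - X" "b \<in> ?B - X"
        using AB ab by auto
      then have "\<exists>a'. a' \<noteq> a \<and> ?A - X = {a, a'}" "\<exists>b'. b' \<noteq> b \<and> ?B - X = {b, b'}"
        using card_2_obtain_other cards by metis+
      then obtain a' b' where a': "a' \<noteq> a" "?A - X = {a, a'}" and b': "b' \<noteq> b" "?B - X = {b, b'}"
        by blast
      have "c - (X \<union> {a, b}) = {a', b'}" "a' \<noteq> b'"
        using a' b' dis cAB by auto
      then show ?thesis by simp
    qed
  next
    case False
    then have "c = component_of C P x"
      using x split mono by (fastforce simp: component_of_def)
    moreover from this have "a \<notin> c" "b \<notin> c" using False by (auto simp: component_of_def)
    moreover have "c \<in> components C P" using calculation(1) x component_of_in by metis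
    moreover have "c - (X \<union> {a, b}) = c - X" using \<open>a \<notin> c\<close> \<open>b \<notin> c\<close> by blast
    ultimately show ?thesis using P[of c] by auto
  qed
qed

section \<open>The operations on ribbon graphs\<close>

text \<open>
  The third pairing of the corners of an edge, followed by the boundary curves of a half-twisted edge.
\<close>

definition edge_diagonals :: "'e \<Rightarrow> 'e corner set set" where
  "edge_diagonals e = {{(e, False, s), (e, True, \<not> s)} | s. True}"

lemma in_corners_of_iff [simp]: "c \<in> corners_of e \<longleftrightarrow> fst c = e"
  by (cases c) (simp add: corners_of_def)

lemma in_corners_iff [simp]: "c \<in> corners G \<longleftrightarrow> fst c \<in> edges G"
  by (simp add: corners_def)

lemma corners_of_explicit:
  "corners_of e = {(e, False, False), (e, False, True), (e, True, False), (e, True, True)}"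
  by (auto simp: corners_of_def)

lemma edge_ends_explicit:
  "edge_ends e = {{(e, False, False), (e, False, True)}, {(e, True, False), (e, True, True)}}"
  unfolding edge_ends_def by (auto simp: ex_bool_eq)

lemma edge_sides_explicit:
  "edge_sides e = {{(e, False, False), (e, True, False)}, {(e, False, True), (e, True, True)}}"
  unfolding edge_sides_def by (auto simp: ex_bool_eq)

lemma edge_diagonals_explicit:
  "edge_diagonals e = {{(e, False, False), (e, True, True)}, {(e, False, True), (e, True, False)}}"
  unfolding edge_diagonals_def by (auto simp: ex_bool_eq)

lemma finite_corners: "ribbon_graph G \<Longrightarrow> finite (corners G)"
  by (simp add: ribbon_graph_def corners_def corners_of_def)

lemma arc_subset: "ribbon_graph G \<Longrightarrow> a \<in> arcs G \<Longrightarrow> a \<subseteq> corners G"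
  unfolding ribbon_graph_def using partition_onD1[of "corners G" "arcs G"] by auto

lemma edges_splice [simp]: "edges (splice G e S) = edges G - {e}"
  by (simp add: splice_def Let_def)

lemma dark_splice [simp]: "dark (splice G e S) = dark G"
  by (simp add: splice_def Let_def)

lemma corners_splice: "corners (splice G e S) = corners G - corners_of e"
  by auto

text \<open>
  The two pairs that make up \<open>S\<close> are joined one after the other; after both, exactly the corners of
  \<open>e\<close> have been passed through, and every component that is not closed has two ends left.
\<close>

lemma ribbon_graph_splice:
  assumes G: "ribbon_graph G" "e \<in> edges G"
    and S: "S = {{p, q}, {r, s}}" "corners_of e = {p, q, r, s}" "distinct [p, q, r, s]"
  shows "ribbon_graph (splice G e S)"
proof -
  let ?C = "corners G" and ?E = "corners_of e"
  define K where "K = components ?C (arcs G \<union> S)"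
  have K: "partition_on ?C K" unfolding K_def by (rule partition_on_components)
  have arcs: "arcs (splice G e S) = {c - ?E | c. c \<in> K \<and> \<not> c \<subseteq> ?E}"
    by (simp add: splice_def Let_def K_def)
  have part: "partition_on ?C (arcs G)" using G by (simp add: ribbon_graph_def)
  have "?E \<subseteq> ?C" using G by auto
  then have in_C: "p \<in> ?C" "q \<in> ?C" "r \<in> ?C" "s \<in> ?C"
    unfolding S(2) by simp_all
  have 0: "card (c - {}) = 2 \<or> c \<subseteq> {}" if "c \<in> components ?C (arcs G)" for c
    using that G by (simp add: components_partition_on[OF part] ribbon_graph_def)
  have 1: "card (c - ({} \<union> {p, q})) = 2 \<or> c \<subseteq> {} \<union> {p, q}"
    if "c \<in> components ?C (insert {p, q} (arcs G))" for c
    by (rule card_component_diff_join_pair[OF 0 _ _ _ that]) (use in_C S(3) in auto)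
  have 2: "card (c - ({} \<union> {p, q} \<union> {r, s})) = 2 \<or> c \<subseteq> {} \<union> {p, q} \<union> {r, s}"
    if "c \<in> components ?C (insert {r, s} (insert {p, q} (arcs G)))" for c
    by (rule card_component_diff_join_pair[OF 1 _ _ _ that]) (use in_C S(3) in auto)
  have eq: "insert {r, s} (insert {p, q} (arcs G)) = arcs G \<union> S" "{} \<union> {p, q} \<union> {r, s} = ?E"
    unfolding S by auto
  have card: "card (c - ?E) = 2" if "c \<in> K" "\<not> c \<subseteq> ?E" for c
    using 2[unfolded eq, folded K_def, OF that(1)] that(2) by simp
  have "partition_on (?C - ?E) (arcs (splice G e S))"
  proof (rule partition_onI)
    show "\<Union> (arcs (splice G e S)) = ?C - ?E"
      unfolding arcs partition_onD1[OF K] by blast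
    show "{} \<notin> arcs (splice G e S)" unfolding arcs by auto
    fix a b assume "a \<in> arcs (splice G e S)" "b \<in> arcs (splice G e S)" "a \<noteq> b"
    then obtain c d where cd: "c \<in> K" "d \<in> K" "a = c - ?E" "b = d - ?E" "c \<noteq> d"
      unfolding arcs by auto
    then have "disjnt c d"
      using partition_onD2[OF K] by (simp add: pairwise_def)
    then show "disjnt a b" unfolding cd disjnt_def by blast
  qed
  then show ?thesis
    using G card unfolding ribbon_graph_def corners_splice
    by (auto simp: arcs)
qed

lemma ribbon_graph_delete: "ribbon_graph G \<Longrightarrow> e \<in> edges G \<Longrightarrow> ribbon_graph (delete G e)"
  unfolding delete_def
  by (rule ribbon_graph_splice[OF _ _ edge_ends_explicit]) (auto simp: corners_of_explicit)

lemma ribbon_graph_contract: "ribbon_graph G \<Longrightarrow> e \<in> edges G \<Longrightarrow> ribbon_graph (contract G e)"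
  unfolding contract_def
  by (rule ribbon_graph_splice[OF _ _ edge_sides_explicit]) (auto simp: corners_of_explicit)

lemma half_twist_half_twist [simp]: "half_twist e (half_twist e c) = c"
  by (cases c) (simp add: half_twist_def)

lemma bij_half_twist: "bij (half_twist e)"
  by (rule o_bij[of "half_twist e"]) (auto simp: fun_eq_iff)

lemma fst_half_twist [simp]: "fst (half_twist e c) = fst c"
  by (cases c) (simp add: half_twist_def)

lemma half_twist_corners: "half_twist e ` corners G = corners G"
proof
  show "corners G \<subseteq> half_twist e ` corners G"
  proof
    fix c assume "c \<in> corners G"
    then show "c \<in> half_twist e ` corners G"
      by (intro image_eqI[of _ _ "half_twist e c"]) auto
  qed
qed auto

lemma partial_petrial_simps [simp]:
  "edges (partial_petrial G e) = edges G"
  "corners (partial_petrial G e) = corners G"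
  "arcs (partial_petrial G e) = (`) (half_twist e) ` arcs G"
  "isolated (partial_petrial G e) = isolated G"
  "dark (partial_petrial H e) = dark H"
  by (auto simp: partial_petrial_def)

lemma ribbon_graph_partial_petrial:
  assumes "ribbon_graph G"
  shows "ribbon_graph (partial_petrial G e)"
proof -
  have inj: "inj (half_twist e)" using bij_half_twist by (rule bij_is_inj)
  have "partition_on (half_twist e ` corners G) ((`) (half_twist e) ` arcs G)"
  proof (rule partition_onI)
    show "\<Union> ((`) (half_twist e) ` arcs G) = half_twist e ` corners G"
      using assms partition_onD1[of "corners G" "arcs G"] by (auto simp: ribbon_graph_def)
    show "{} \<notin> (`) (half_twist e) ` arcs G"
      using assms partition_onD3[of "corners G" "arcs G"] by (auto simp: ribbon_graph_def)
    fix a b assume "a \<in> (`) (half_twist e) ` arcs G" "b \<in> (`) (half_twist e) ` arcs G" "a \<noteq> b"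
    then obtain c d where cd: "c \<in> arcs G" "d \<in> arcs G" "c \<noteq> d"
      "a = half_twist e ` c" "b = half_twist e ` d" by auto
    then have "c \<inter> d = {}"
      using assms partition_onD2[of "corners G" "arcs G"]
      by (auto simp: ribbon_graph_def pairwise_def disjnt_def)
    then show "disjnt a b"
      unfolding cd disjnt_def by (simp add: image_Int[OF inj, symmetric])
  qed
  then have "partition_on (corners G) ((`) (half_twist e) ` arcs G)"
    by (simp only: half_twist_corners)
  moreover have "card (half_twist e ` a) = card a" for a
    using inj by (intro card_image) (auto intro: inj_on_subset)
  ultimately show ?thesis using assms by (auto simp: ribbon_graph_def)
qed

lemma light_ops [simp]:
  "light (contract_to_point G e) = light G - {e}"
  "light (splice G e S) = light G - {e}"
  "light (partial_petrial G e) = light G"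
  by (auto simp: light_def contract_to_point_def)

lemma ep_ribbon_graph_ops:
  assumes "ep_ribbon_graph G" "e \<in> light G"
  shows "ep_ribbon_graph (contract_to_point G e)" "ep_ribbon_graph (contract G e)"
    "ep_ribbon_graph (delete G e)" "ep_ribbon_graph (penrose_contract G e)"
proof -
  have G: "ribbon_graph G" "dark G \<subseteq> edges G - {e}" "e \<in> edges G"
    using assms by (auto simp: ep_ribbon_graph_def light_def)
  have "ribbon_graph (contract_to_point G e)"
    using G by (simp add: ribbon_graph_def contract_to_point_def corners_def)
  then show "ep_ribbon_graph (contract_to_point G e)"
    using G by (auto simp: ep_ribbon_graph_def contract_to_point_def)
  show "ep_ribbon_graph (contract G e)"
    using G ribbon_graph_contract[of G e] by (simp add: ep_ribbon_graph_def contract_def)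
  show "ep_ribbon_graph (delete G e)"
    using G ribbon_graph_delete[of G e] by (simp add: ep_ribbon_graph_def delete_def)
  show "ep_ribbon_graph (penrose_contract G e)"
    using G ribbon_graph_contract[OF ribbon_graph_partial_petrial, of G e e]
    by (simp add: ep_ribbon_graph_def contract_def penrose_contract_def)
qed

lemma light_children [simp]:
  "light (contract G e) = light G - {e}" "light (delete G e) = light G - {e}"
  "light (penrose_contract G e) = light G - {e}"
  by (simp_all add: contract_def delete_def penrose_contract_def)

lemma finite_light: "ep_ribbon_graph G \<Longrightarrow> finite (light G)"
  by (simp add: ep_ribbon_graph_def ribbon_graph_def light_def)

section \<open>The state sum\<close>

text \<open>
  The choices at a light edge are named by the variables that they contribute to \<open>Omega\<close>.
  Contraction to a point joins all four corners of the edge, the other three operations pair them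
  up.  The variable \<open>It\<close> counts components and is not the weight of a choice, so its value here is
  arbitrary.
\<close>

fun smoothing :: "'e \<Rightarrow> indet \<Rightarrow> 'e corner set set" where
  "smoothing e Iw = {corners_of e}"
| "smoothing e Ix = edge_sides e"
| "smoothing e Iy = edge_ends e"
| "smoothing e Iz = edge_diagonals e"
| "smoothing e It = {}"

abbreviation smoothings :: "indet set" where
  "smoothings \<equiv> {Iw, Ix, Iy, Iz}"

text \<open>
  A dark edge is treated like a light one that has been contracted to a point.
\<close>

definition smoothed :: "'e ep_ribbon_graph \<Rightarrow> ('e \<Rightarrow> indet) \<Rightarrow> 'e corner set set" where
  "smoothed G \<sigma> = (\<Union>e\<in>light G. smoothing e (\<sigma> e)) \<union> corners_of ` dark G"

definition loops :: "'e ep_ribbon_graph \<Rightarrow> ('e \<Rightarrow> indet) \<Rightarrow> nat" where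
  "loops G \<sigma> = card (components (corners G) (arcs G \<union> smoothed G \<sigma>)) + isolated G"

definition state_sum :: "(indet \<Rightarrow> 'a::comm_ring_1) \<Rightarrow> 'e ep_ribbon_graph \<Rightarrow> 'a" where
  "state_sum a G =
     (\<Sum>\<sigma>\<in>light G \<rightarrow>\<^sub>E smoothings. (\<Prod>e\<in>light G. a (\<sigma> e)) * a It ^ loops G \<sigma>)"

lemma smoothing_subset: "p \<in> smoothing e s \<Longrightarrow> p \<subseteq> corners_of e"
  by (cases s) (auto simp: edge_sides_def edge_ends_def edge_diagonals_def)

text \<open>
  Isolates the contribution of the edge \<open>e\<close>.  The remaining part is also the family that belongs to
  \<open>\<sigma>\<close> after \<open>e\<close> has been spliced out.
\<close>

lemma smoothed_upd:
  assumes "e \<in> light G"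
  shows "smoothed G (\<sigma>(e := s)) =
    smoothing e s \<union> ((\<Union>f\<in>light G - {e}. smoothing f (\<sigma> f)) \<union> corners_of ` dark G)"
  using assms by (auto simp: smoothed_def split: if_splits)

lemma smoothed_elsewhere:
  assumes "ep_ribbon_graph G" "e \<in> light G"
    and "p \<in> (\<Union>f\<in>light G - {e}. smoothing f (\<sigma> f)) \<union> corners_of ` dark G"
  obtains f where "f \<in> edges G" "f \<noteq> e" "p \<subseteq> corners_of f"
  using assms(3)
proof
  assume "p \<in> (\<Union>f\<in>light G - {e}. smoothing f (\<sigma> f))"
  then obtain f where "f \<in> light G" "f \<noteq> e" "p \<in> smoothing f (\<sigma> f)" by auto
  then show thesis using that[of f] smoothing_subset[of p f "\<sigma> f"] by (simp add: light_def)
next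
  assume "p \<in> corners_of ` dark G"
  then obtain f where "f \<in> dark G" "p = corners_of f" by auto
  then show thesis using that[of f] assms by (auto simp: light_def ep_ribbon_graph_def)
qed

text \<open>
  Making the choice at \<open>e\<close> beforehand or together with all the others gives the same curves.  The
  closed curves that meet only \<open>e\<close> are the isolated vertices created by the splice.
\<close>

lemma loops_splice:
  assumes G: "ep_ribbon_graph G" "e \<in> light G" and S: "S = smoothing e s"
  shows "loops (splice G e S) \<sigma> = loops G (\<sigma>(e := s))"
proof -
  let ?R = "(\<Union>f\<in>light G - {e}. smoothing f (\<sigma> f)) \<union> corners_of ` dark G"
  let ?K = "components (corners G) (arcs G \<union> S)"
  let ?A = "{c - corners_of e | c. c \<in> ?K \<and> \<not> c \<subseteq> corners_of e}"
  have rg: "ribbon_graph G" and e: "e \<in> edges G" "e \<notin> dark G" "dark G \<subseteq> edges G"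
    using G by (auto simp: ep_ribbon_graph_def light_def)
  have "p \<subseteq> corners G - corners_of e" if "p \<in> ?R" for p
  proof -
    from smoothed_elsewhere[OF G that]
    obtain f where "f \<in> edges G" "f \<noteq> e" "p \<subseteq> corners_of f" .
    then show ?thesis by auto
  qed
  moreover have "p \<subseteq> corners G" if "p \<in> arcs G \<union> S" for p
  proof -
    have "corners_of e \<subseteq> corners G" using e by auto
    then show ?thesis using that arc_subset[OF rg] smoothing_subset[of p e s] S by auto
  qed
  ultimately have "card (components (corners G) ((arcs G \<union> S) \<union> ?R)) =
      card (components (corners G - corners_of e) (?A \<union> ?R)) + card {c \<in> ?K. c \<subseteq> corners_of e}"
    by (intro card_components_splice finite_corners rg)
  moreover have "arcs (splice G e S) = ?A"
    "isolated (splice G e S) = isolated G + card {c \<in> ?K. c \<subseteq> corners_of e}"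
    by (simp_all add: splice_def Let_def)
  moreover have "smoothed (splice G e S) \<sigma> = ?R" by (simp add: smoothed_def)
  ultimately show ?thesis
    by (simp add: loops_def corners_splice smoothed_upd[OF G(2)] S Un_assoc)
qed

lemma loops_contract_to_point:
  assumes "e \<in> light G"
  shows "loops (contract_to_point G e) \<sigma> = loops G (\<sigma>(e := Iw))"
proof -
  have "smoothed (contract_to_point G e) \<sigma> = smoothed G (\<sigma>(e := Iw))"
    unfolding smoothed_upd[OF assms] by (auto simp: smoothed_def contract_to_point_def light_def)
  moreover have "corners (contract_to_point G e) = corners G"
    "arcs (contract_to_point G e) = arcs G" "isolated (contract_to_point G e) = isolated G"
    by (simp_all add: contract_to_point_def corners_def)
  ultimately show ?thesis by (simp add: loops_def)
qed

lemma half_twist_other: "p \<subseteq> corners_of f \<Longrightarrow> f \<noteq> e \<Longrightarrow> half_twist e ` p = p"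
proof -
  assume "p \<subseteq> corners_of f" "f \<noteq> e"
  then have "half_twist e c = c" if "c \<in> p" for c
    using that by (cases c) (auto simp: half_twist_def)
  then show ?thesis by simp
qed

lemma half_twist_diagonals: "(`) (half_twist e) ` edge_diagonals e = edge_sides e"
  by (simp add: edge_diagonals_explicit edge_sides_explicit half_twist_def insert_commute)

text \<open>
  The half-twist carries the diagonals of \<open>e\<close> to its sides and fixes the corners of all other edges,
  so it identifies the curves of the state with \<open>Iz\<close> at \<open>e\<close> with those of the partial Petrial with
  \<open>Ix\<close> at \<open>e\<close>.
\<close>

lemma loops_penrose_contract:
  assumes G: "ep_ribbon_graph G" "e \<in> light G"
  shows "loops (penrose_contract G e) \<sigma> = loops G (\<sigma>(e := Iz))"
proof -
  let ?R = "(\<Union>f\<in>light G - {e}. smoothing f (\<sigma> f)) \<union> corners_of ` dark G"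
  let ?P = "partial_petrial G e"
  have P: "ep_ribbon_graph ?P" "e \<in> light ?P"
    using G ribbon_graph_partial_petrial[of G e] by (simp_all add: ep_ribbon_graph_def)
  have "half_twist e ` p = p" if "p \<in> ?R" for p
  proof -
    from smoothed_elsewhere[OF G that]
    obtain f where "f \<in> edges G" "f \<noteq> e" "p \<subseteq> corners_of f" .
    then show ?thesis by (intro half_twist_other)
  qed
  then have R: "(`) (half_twist e) ` ?R = ?R" by simp
  have "loops (penrose_contract G e) \<sigma> = loops ?P (\<sigma>(e := Ix))"
    unfolding penrose_contract_def contract_def by (rule loops_splice[OF P]) simp
  also have "\<dots> = card (components (half_twist e ` corners G)
      ((`) (half_twist e) ` (arcs G \<union> (edge_diagonals e \<union> ?R)))) + isolated G"
    unfolding loops_def smoothed_upd[OF P(2)] image_Un R[unfolded image_Un] half_twist_corners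
      half_twist_diagonals by simp
  also have "\<dots> = loops G (\<sigma>(e := Iz))"
    unfolding loops_def smoothed_upd[OF G(2)] card_components_image[OF bij_half_twist] by simp
  finally show ?thesis .
qed

text \<open>
  Here \<open>H s\<close> is what remains of \<open>G\<close> once the choice \<open>s\<close> has been made at \<open>e\<close>; the states are grouped
  according to this choice.
\<close>

lemma state_sum_expand:
  assumes "ep_ribbon_graph G" "e \<in> light G"
    and "\<And>s \<sigma>. s \<in> smoothings \<Longrightarrow> loops (H s) \<sigma> = loops G (\<sigma>(e := s))"
    and "\<And>s. s \<in> smoothings \<Longrightarrow> light (H s) = light G - {e}"
  shows "state_sum a G = (\<Sum>s\<in>smoothings. a s * state_sum a (H s))"
proof -
  let ?L = "light G - {e}"
  have L: "light G = insert e ?L" "finite ?L" using assms(2) finite_light[OF assms(1)] by auto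
  let ?t = "\<lambda>\<sigma>. (\<Prod>e\<in>light G. a (\<sigma> e)) * a It ^ loops G \<sigma>"
  have inj: "inj_on (\<lambda>(s, \<sigma>). \<sigma>(e := s)) (smoothings \<times> (?L \<rightarrow>\<^sub>E smoothings))"
    by (rule inj_combinator) simp
  have "state_sum a G = sum ?t (insert e ?L \<rightarrow>\<^sub>E smoothings)"
    unfolding state_sum_def L(1)[symmetric] ..
  also have "\<dots> = (\<Sum>(s, \<sigma>)\<in>smoothings \<times> (?L \<rightarrow>\<^sub>E smoothings). ?t (\<sigma>(e := s)))"
    unfolding PiE_insert_eq by (subst sum.reindex[OF inj]) (simp add: case_prod_unfold)
  also have "\<dots> = (\<Sum>s\<in>smoothings. \<Sum>\<sigma>\<in>?L \<rightarrow>\<^sub>E smoothings. ?t (\<sigma>(e := s)))"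
    by (rule sum.cartesian_product[symmetric])
  also have "\<dots> = (\<Sum>s\<in>smoothings. a s * state_sum a (H s))"
  proof (rule sum.cong[OF refl])
    fix s assume s: "s \<in> smoothings"
    have "?t (\<sigma>(e := s)) = a s * ((\<Prod>f\<in>?L. a (\<sigma> f)) * a It ^ loops (H s) \<sigma>)" for \<sigma>
    proof -
      have "(\<Prod>f\<in>light G. a ((\<sigma>(e := s)) f)) = a s * (\<Prod>f\<in>?L. a ((\<sigma>(e := s)) f))"
        by (subst L(1), subst prod.insert) (use L(2) in auto)
      also have "(\<Prod>f\<in>?L. a ((\<sigma>(e := s)) f)) = (\<Prod>f\<in>?L. a (\<sigma> f))"
        by (rule prod.cong) auto
      finally show ?thesis by (simp only: assms(3)[OF s] mult.assoc)
    qed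
    then show "(\<Sum>\<sigma>\<in>?L \<rightarrow>\<^sub>E smoothings. ?t (\<sigma>(e := s))) = a s * state_sum a (H s)"
      by (simp only: state_sum_def assms(4)[OF s] sum_distrib_left)
  qed
  finally show ?thesis .
qed

lemma state_sum_rec:
  assumes "ep_ribbon_graph G" "e \<in> light G"
  shows "state_sum a G = a Iw * state_sum a (contract_to_point G e) + a Ix * state_sum a (contract G e)
    + a Iy * state_sum a (delete G e) + a Iz * state_sum a (penrose_contract G e)"
proof -
  let ?H = "case_indet (contract_to_point G e) (contract G e) (delete G e) (penrose_contract G e) G"
  have "state_sum a G = (\<Sum>s\<in>smoothings. a s * state_sum a (?H s))"
    by (rule state_sum_expand[OF assms])
      (use assms in \<open>auto simp: loops_contract_to_point loops_penrose_contract contract_def delete_def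
        loops_splice[where s = Ix] loops_splice[where s = Iy]\<close>)
  then show ?thesis by (simp add: add.assoc)
qed

lemma state_sum_no_light:
  assumes "ep_ribbon_graph G" "light G = {}"
  shows "state_sum a G = a It ^ kappa G"
proof -
  have "dark G = edges G" using assms by (auto simp: ep_ribbon_graph_def light_def)
  then show ?thesis
    using assms(2) by (simp add: state_sum_def loops_def smoothed_def kappa_def)
qed

section \<open>Omega is the state sum\<close>

definition eval_monomial :: "(indet \<Rightarrow> 'a::comm_ring_1) \<Rightarrow> (indet \<Rightarrow>\<^sub>0 nat) \<Rightarrow> 'a" where
  "eval_monomial a m = (\<Prod>v\<in>Poly_Mapping.keys m. a v ^ Poly_Mapping.lookup m v)"

lemma eval_monomial_superset:
  assumes "finite V" "Poly_Mapping.keys m \<subseteq> V"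
  shows "eval_monomial a m = (\<Prod>v\<in>V. a v ^ Poly_Mapping.lookup m v)"
  unfolding eval_monomial_def using assms
  by (intro prod.mono_neutral_left) (auto simp: in_keys_iff)

lemma eval_monomial_add: "eval_monomial a (m + n) = eval_monomial a m * eval_monomial a n"
proof -
  let ?V = "Poly_Mapping.keys m \<union> Poly_Mapping.keys n"
  have "Poly_Mapping.keys (m + n) \<subseteq> ?V" by (rule keys_add)
  then show ?thesis
    by (simp add: eval_monomial_superset[of ?V] lookup_add power_add prod.distrib)
qed

text \<open>
  Enlarging the index set to one that does not depend on \<open>p\<close> makes the sums for \<open>p\<close>, \<open>q\<close> and \<open>p + q\<close>
  comparable; the same device serves for monomials.
\<close>

lemma eval_poly_superset:
  assumes "finite M" "Poly_Mapping.keys p \<subseteq> M"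
  shows "eval_poly a p = (\<Sum>m\<in>M. of_int (Poly_Mapping.lookup p m) * eval_monomial a m)"
  unfolding eval_poly_def eval_monomial_def using assms
  by (intro sum.mono_neutral_left) (auto simp: in_keys_iff)

lemma eval_poly_add: "eval_poly a (p + q) = eval_poly a p + eval_poly a q"
proof -
  let ?M = "Poly_Mapping.keys p \<union> Poly_Mapping.keys q"
  have "Poly_Mapping.keys (p + q) \<subseteq> ?M" by (rule keys_add)
  then show ?thesis
    by (simp add: eval_poly_superset[of ?M] lookup_add distrib_right sum.distrib)
qed

lemma eval_poly_0: "eval_poly a 0 = 0"
  by (simp add: eval_poly_def)

lemma eval_poly_sum: "eval_poly a (sum f A) = (\<Sum>x\<in>A. eval_poly a (f x))"
  by (induction A rule: infinite_finite_induct) (simp_all add: eval_poly_0 eval_poly_add)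

lemma eval_poly_single:
  "eval_poly a (Poly_Mapping.single m c) = of_int c * eval_monomial a m"
  by (subst eval_poly_superset[of "{m}"]) auto

lemma poly_as_sum_of_singles:
  fixes p :: "'b \<Rightarrow>\<^sub>0 'c::comm_monoid_add"
  shows "p = (\<Sum>m\<in>Poly_Mapping.keys p. Poly_Mapping.single m (Poly_Mapping.lookup p m))"
proof (rule poly_mapping_eqI)
  fix k
  show "Poly_Mapping.lookup p k = Poly_Mapping.lookup
      (\<Sum>m\<in>Poly_Mapping.keys p. Poly_Mapping.single m (Poly_Mapping.lookup p m)) k"
    by (simp add: lookup_sum lookup_single when_def in_keys_iff)
qed

lemma eval_poly_mult: "eval_poly a (p * q) = eval_poly a p * eval_poly a q"
proof -
  let ?p = "\<lambda>m. Poly_Mapping.single m (Poly_Mapping.lookup p m)"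
  let ?q = "\<lambda>m. Poly_Mapping.single m (Poly_Mapping.lookup q m)"
  have "p * q = sum ?p (Poly_Mapping.keys p) * sum ?q (Poly_Mapping.keys q)"
    using poly_as_sum_of_singles[of p] poly_as_sum_of_singles[of q] by metis
  also have "eval_poly a \<dots> =
      (\<Sum>m\<in>Poly_Mapping.keys p. \<Sum>n\<in>Poly_Mapping.keys q. eval_poly a (?p m) * eval_poly a (?q n))"
    by (simp add: sum_product eval_poly_sum mult_single eval_poly_single eval_monomial_add algebra_simps)
  also have "\<dots> = eval_poly a p * eval_poly a q"
    by (simp add: sum_product[symmetric] eval_poly_single)
      (simp add: eval_poly_def eval_monomial_def)
  finally show ?thesis .
qed

lemma eval_poly_Var: "eval_poly a (Var v) = a v"
  by (simp add: Var_def eval_poly_single eval_monomial_def)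

lemma eval_poly_1: "eval_poly a 1 = 1"
  unfolding single_one[symmetric] eval_poly_single by (simp add: eval_monomial_def)

lemma eval_poly_power: "eval_poly a (p ^ n) = eval_poly a p ^ n"
  by (induction n) (simp_all add: eval_poly_1 eval_poly_mult)

text \<open>
  That the two clauses defining \<open>Omega\<close> are consistent, i.e. that the result does not depend on the
  order in which the edges are processed, is not obvious.  The state sum, which mentions no order,
  provides a function satisfying both.
\<close>

lemma is_Omega_Omega: "is_Omega (Omega :: 'e ep_ribbon_graph \<Rightarrow> wxyzt_poly)"
proof -
  have "is_Omega (state_sum Var :: 'e ep_ribbon_graph \<Rightarrow> wxyzt_poly)"
    unfolding is_Omega_def
    by (intro conjI allI impI ballI) (rule state_sum_no_light state_sum_rec; assumption)+
  then show ?thesis unfolding Omega_def by (rule someI[of is_Omega])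
qed

text \<open>
  Uniqueness: the two clauses determine the value by induction on the number of light edges, since
  the four operations preserve edge-point ribbon graphs.
\<close>

lemma eval_Omega:
  assumes "ep_ribbon_graph G"
  shows "eval_poly a (Omega G) = state_sum a G"
  using assms
proof (induction "card (light G)" arbitrary: G rule: less_induct)
  case less
  show ?case
  proof (cases "light G = {}")
    case True
    then have "Omega G = Var It ^ kappa G"
      using is_Omega_Omega less.prems unfolding is_Omega_def by blast
    then show ?thesis
      using True less.prems by (simp add: eval_poly_power eval_poly_Var state_sum_no_light)
  next
    case False
    then obtain e where e: "e \<in> light G" by blast
    have "card (light G - {e}) < card (light G)"
      using e finite_light[OF less.prems] by (rule card_Diff1_less[rotated])
    then have IH: "eval_poly a (Omega H) = state_sum a H"
      if "ep_ribbon_graph H" "light H = light G - {e}" for H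
      using less.hyps[of H] that by simp
    have "Omega G = Var Iw * Omega (contract_to_point G e) + Var Ix * Omega (contract G e)
            + Var Iy * Omega (delete G e) + Var Iz * Omega (penrose_contract G e)"
      using is_Omega_Omega less.prems e unfolding is_Omega_def by blast
    then show ?thesis
      by (simp add: eval_poly_add eval_poly_mult eval_poly_Var IH
          ep_ribbon_graph_ops[OF less.prems e] state_sum_rec[OF less.prems e])
  qed
qed

section \<open>Valuations\<close>

definition compatible :: "'e ribbon_graph \<Rightarrow> ('e medial_edge \<Rightarrow> nat) \<Rightarrow> 'e \<Rightarrow> indet \<Rightarrow> bool" where
  "compatible G \<phi> e s \<longleftrightarrow>
     (\<forall>p\<in>smoothing e s. \<forall>c\<in>p. \<forall>d\<in>p. half_edge_colour G \<phi> c = half_edge_colour G \<phi> d)"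

lemma half_edge_colour_arc:
  assumes "ribbon_graph G" "a \<in> arcs G" "c \<in> a"
  shows "half_edge_colour G \<phi> c = \<phi> (Arc a)"
proof -
  have "disjoint (arcs G)"
    using assms(1) partition_onD2[of "corners G" "arcs G"] by (simp add: ribbon_graph_def)
  then have "b = a" if "b \<in> arcs G" "c \<in> b" for b
    using that assms(2,3) disjointD[of "arcs G" a b] by blast
  then have "(THE a. a \<in> arcs G \<and> c \<in> a) = a"
    using assms(2,3) by (intro the_equality) blast+
  then show ?thesis by (simp add: half_edge_colour_def)
qed

lemma corner_in_arc:
  assumes "ribbon_graph G" "c \<in> corners G"
  obtains a where "a \<in> arcs G" "c \<in> a"
  using assms partition_onD1[of "corners G" "arcs G"] unfolding ribbon_graph_def by blast

lemma half_edge_colour_in: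
  assumes "ribbon_graph G" "\<phi> \<in> medial_edges G \<rightarrow>\<^sub>E T" "c \<in> corners G"
  shows "half_edge_colour G \<phi> c \<in> T"
proof -
  obtain a where a: "a \<in> arcs G" "c \<in> a" using corner_in_arc[OF assms(1,3)] .
  then have "\<phi> (Arc a) \<in> T" using assms(2) by (intro PiE_mem[OF assms(2)]) (simp add: medial_edges_def)
  then show ?thesis using half_edge_colour_arc[OF assms(1) a] by simp
qed

lemma finite_medial_edges:
  assumes "ribbon_graph G"
  shows "finite (medial_edges G)"
proof -
  have "finite (arcs G)"
    using finite_elements[OF finite_corners[OF assms]] assms by (simp add: ribbon_graph_def)
  then show ?thesis by (simp add: medial_edges_def)
qed

text \<open>
  A colouring of the medial graph amounts to a colouring of the corners that is constant on arcs,
  together with independent colours of the free-loops.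
\<close>

lemma card_constant_medial_colourings:
  assumes G: "ribbon_graph G" and Q: "\<And>p. p \<in> Q \<Longrightarrow> p \<subseteq> corners G" and "finite T"
  shows "card {\<phi> \<in> medial_edges G \<rightarrow>\<^sub>E T.
      \<forall>p\<in>Q. \<forall>c\<in>p. \<forall>d\<in>p. half_edge_colour G \<phi> c = half_edge_colour G \<phi> d}
    = card T ^ (card (components (corners G) (arcs G \<union> Q)) + isolated G)"
proof -
  let ?M = "medial_edges G" and ?C = "corners G" and ?I = "{..<isolated G}"
  let ?h = "half_edge_colour G"
  let ?A = "{\<phi> \<in> ?M \<rightarrow>\<^sub>E T. \<forall>p\<in>Q. \<forall>c\<in>p. \<forall>d\<in>p. ?h \<phi> c = ?h \<phi> d}"
  let ?F = "{f \<in> ?C \<rightarrow>\<^sub>E T. \<forall>p\<in>arcs G \<union> Q. \<forall>x\<in>p. \<forall>y\<in>p. f x = f y}"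
  define pick where "pick a = (SOME c. c \<in> a)" for a :: "'a corner set"
  have pick: "pick a \<in> a" if "a \<in> arcs G" for a
  proof -
    have "card a = 2" using that G by (simp add: ribbon_graph_def)
    then have "a \<noteq> {}" by auto
    then show ?thesis unfolding pick_def by (rule some_in_eq[THEN iffD2])
  qed
  have pick_in: "pick a \<in> ?C" if "a \<in> arcs G" for a
    using pick[OF that] arc_subset[OF G that] by blast
  \<comment> \<open>The two directions of this correspondence; \<open>pick\<close> chooses a corner at which to read off the
    colour of an arc.\<close>
  define halves where "halves \<phi> = (\<lambda>c\<in>?C. ?h \<phi> c, \<lambda>i\<in>?I. \<phi> (Free_loop i))"
    for \<phi> :: "'a medial_edge \<Rightarrow> nat"
  define glue where
    "glue fg = (\<lambda>m\<in>?M. case m of Arc a \<Rightarrow> fst fg (pick a) | Free_loop i \<Rightarrow> snd fg i)"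
    for fg :: "('a corner \<Rightarrow> nat) \<times> (nat \<Rightarrow> nat)"
  have glue_arc: "glue (f, g) (Arc a) = f (pick a)" if "a \<in> arcs G" for f g a
    using that by (simp add: glue_def medial_edges_def)
  have glue_loop: "glue (f, g) (Free_loop i) = g i" if "i \<in> ?I" for f g i
    using that by (simp add: glue_def medial_edges_def)
  have glue_h: "?h (glue (f, g)) c = f c" if f: "f \<in> ?F" and c: "c \<in> ?C" for f g c
  proof -
    obtain a where a: "a \<in> arcs G" "c \<in> a" using corner_in_arc[OF G c] .
    then have "f (pick a) = f c" using f pick[OF a(1)] by auto
    then show ?thesis using half_edge_colour_arc[OF G a] glue_arc[OF a(1)] by simp
  qed
  have "bij_betw halves ?A (?F \<times> (?I \<rightarrow>\<^sub>E T))"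
  proof (rule bij_betw_byWitness[where f' = glue])
    show "\<forall>\<phi>\<in>?A. glue (halves \<phi>) = \<phi>"
    proof (intro ballI ext)
      fix \<phi> m assume "\<phi> \<in> ?A"
      then have \<phi>: "\<phi> \<in> ?M \<rightarrow>\<^sub>E T" by simp
      show "glue (halves \<phi>) m = \<phi> m"
      proof (cases "m \<in> ?M")
        case True
        then consider a where "m = Arc a" "a \<in> arcs G" | i where "m = Free_loop i" "i \<in> ?I"
          by (auto simp: medial_edges_def)
        then show ?thesis
        proof cases
          case 1
          then show ?thesis
            using pick_in[of a] half_edge_colour_arc[OF G 1(2) pick[OF 1(2)], of \<phi>]
            by (simp add: halves_def glue_arc)
        next
          case 2
          then show ?thesis by (simp add: halves_def glue_loop)
        qed
      next
        case False
        then show ?thesis using PiE_arb[OF \<phi> False] by (simp add: glue_def halves_def)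
      qed
    qed
    show "\<forall>fg\<in>?F \<times> (?I \<rightarrow>\<^sub>E T). halves (glue fg) = fg"
    proof
      fix fg assume "fg \<in> ?F \<times> (?I \<rightarrow>\<^sub>E T)"
      then obtain f g where fg: "fg = (f, g)" "f \<in> ?F" "g \<in> ?I \<rightarrow>\<^sub>E T" by blast
      then have f: "f \<in> ?C \<rightarrow>\<^sub>E T" by simp
      have "(\<lambda>c\<in>?C. ?h (glue (f, g)) c) = f"
      proof
        fix c show "(\<lambda>c\<in>?C. ?h (glue (f, g)) c) c = f c"
          using glue_h[OF fg(2)] PiE_arb[OF f, of c] by (cases "c \<in> ?C") simp_all
      qed
      moreover have "(\<lambda>i\<in>?I. glue (f, g) (Free_loop i)) = g"
      proof
        fix i show "(\<lambda>i\<in>?I. glue (f, g) (Free_loop i)) i = g i"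
          using glue_loop PiE_arb[OF fg(3), of i] by (cases "i \<in> ?I") simp_all
      qed
      ultimately show "halves (glue fg) = fg" by (simp add: halves_def fg(1))
    qed
    show "halves ` ?A \<subseteq> ?F \<times> (?I \<rightarrow>\<^sub>E T)"
    proof (rule image_subsetI)
      fix \<phi> assume \<phi>A: "\<phi> \<in> ?A"
      then have \<phi>: "\<phi> \<in> ?M \<rightarrow>\<^sub>E T" by simp
      have "(\<lambda>c\<in>?C. ?h \<phi> c) \<in> ?C \<rightarrow>\<^sub>E T"
        using half_edge_colour_in[OF G \<phi>] by (simp add: restrict_PiE_iff)
      moreover have "(\<lambda>c\<in>?C. ?h \<phi> c) x = (\<lambda>c\<in>?C. ?h \<phi> c) y"
        if "p \<in> arcs G \<union> Q" "x \<in> p" "y \<in> p" for p x y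
      proof -
        have "p \<subseteq> ?C" using that(1) Q arc_subset[OF G] by auto
        then have "x \<in> ?C" "y \<in> ?C" using that by auto
        moreover have "?h \<phi> x = ?h \<phi> y"
        proof (cases "p \<in> arcs G")
          case True
          then show ?thesis using half_edge_colour_arc[OF G True] that by simp
        next
          case False
          then have "p \<in> Q" using that(1) by simp
          then show ?thesis using \<phi>A that(2,3) by blast
        qed
        ultimately show ?thesis by simp
      qed
      moreover have "(\<lambda>i\<in>?I. \<phi> (Free_loop i)) \<in> ?I \<rightarrow>\<^sub>E T"
        using PiE_mem[OF \<phi>] by (simp add: restrict_PiE_iff medial_edges_def)
      ultimately show "halves \<phi> \<in> ?F \<times> (?I \<rightarrow>\<^sub>E T)"
        unfolding halves_def by (intro SigmaI CollectI conjI ballI)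
    qed
    show "glue ` (?F \<times> (?I \<rightarrow>\<^sub>E T)) \<subseteq> ?A"
    proof (rule image_subsetI)
      fix fg assume "fg \<in> ?F \<times> (?I \<rightarrow>\<^sub>E T)"
      then obtain f g where fg: "fg = (f, g)" "f \<in> ?F" "g \<in> ?I \<rightarrow>\<^sub>E T" by blast
      then have f: "f \<in> ?C \<rightarrow>\<^sub>E T" by simp
      have "f (pick a) \<in> T" if "a \<in> arcs G" for a
        using PiE_mem[OF f pick_in[OF that]] .
      then have "glue (f, g) \<in> ?M \<rightarrow>\<^sub>E T"
        unfolding glue_def using PiE_mem[OF fg(3)]
        by (auto simp: restrict_PiE_iff medial_edges_def)
      moreover have "?h (glue (f, g)) c = ?h (glue (f, g)) d" if "p \<in> Q" "c \<in> p" "d \<in> p" for p c d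
      proof -
        have "c \<in> ?C" "d \<in> ?C" using Q[OF that(1)] that by auto
        moreover have "f c = f d" using fg(2) that by auto
        ultimately show ?thesis using glue_h[OF fg(2)] by simp
      qed
      ultimately show "glue fg \<in> ?A" unfolding fg(1) by (intro CollectI conjI ballI)
    qed
  qed
  then have "card ?A = card ?F * card (?I \<rightarrow>\<^sub>E T)"
    by (simp add: bij_betw_same_card card_cartesian_product)
  also have "card ?F = card T ^ card (components ?C (arcs G \<union> Q))"
    by (rule card_colourings) (use finite_corners[OF G] Q arc_subset[OF G] assms(3) in auto)
  also have "card (?I \<rightarrow>\<^sub>E T) = card T ^ isolated G"
    by (simp add: card_funcsetE)
  finally show ?thesis by (simp add: power_add)
qed

lemma configuration_iff:
  fixes G \<phi> e
  defines "h \<equiv> \<lambda>i j. half_edge_colour G \<phi> (e, i, j)"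
  shows "total_at G \<phi> e \<longleftrightarrow>
      h False False = h False True \<and> h False False = h True False \<and> h False False = h True True"
    and "white_at G \<phi> e \<longleftrightarrow> h False False = h True False \<and> h False True = h True True \<and>
      h False False \<noteq> h False True"
    and "black_at G \<phi> e \<longleftrightarrow> h False False = h False True \<and> h True False = h True True \<and>
      h False False \<noteq> h True False"
    and "crossing_at G \<phi> e \<longleftrightarrow> h False False = h True True \<and> h False True = h True False \<and>
      h False False \<noteq> h False True"
  by (auto simp: h_def total_at_def white_at_def black_at_def crossing_at_def corners_of_explicit)

lemma constant_on_pairs:
  "(\<forall>p\<in>{{u, v}, {x, y}}. \<forall>c\<in>p. \<forall>d\<in>p. f c = f d) \<longleftrightarrow> f u = f v \<and> f x = f y"
  by auto

lemma constant_on_four: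
  "(\<forall>p\<in>{{u, v, x, y}}. \<forall>c\<in>p. \<forall>d\<in>p. f c = f d) \<longleftrightarrow> f u = f v \<and> f u = f x \<and> f u = f y"
  by auto

text \<open>
  A total configuration is compatible with all four choices, while a white, black or crossing one is
  compatible with a single choice, the pairing along sides, ends or diagonals respectively.  The
  overlap at total configurations is what turns \<open>w\<close> into \<open>w - x - y - z\<close>.
\<close>

lemma compatible_iff:
  "compatible G \<phi> e Iw \<longleftrightarrow> total_at G \<phi> e"
  "compatible G \<phi> e Ix \<longleftrightarrow> white_at G \<phi> e \<or> total_at G \<phi> e"
  "compatible G \<phi> e Iy \<longleftrightarrow> black_at G \<phi> e \<or> total_at G \<phi> e"
  "compatible G \<phi> e Iz \<longleftrightarrow> crossing_at G \<phi> e \<or> total_at G \<phi> e"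
  unfolding compatible_def configuration_iff smoothing.simps corners_of_explicit edge_sides_explicit
    edge_ends_explicit edge_diagonals_explicit constant_on_pairs constant_on_four
  by auto

lemma configurations_exclusive:
  "total_at G \<phi> e \<Longrightarrow> \<not> white_at G \<phi> e \<and> \<not> black_at G \<phi> e \<and> \<not> crossing_at G \<phi> e"
  "white_at G \<phi> e \<Longrightarrow> \<not> black_at G \<phi> e \<and> \<not> crossing_at G \<phi> e"
  "black_at G \<phi> e \<Longrightarrow> \<not> crossing_at G \<phi> e"
  unfolding configuration_iff by auto

lemma even_multiplicities_imp_pairing:
  fixes p q r s :: 'b
  assumes "\<And>i. i \<in> {p, q, r} \<Longrightarrow>
    even (of_bool (p = i) + of_bool (q = i) + of_bool (r = i) + of_bool (s = i) :: nat)"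
  shows "(p = q \<and> r = s) \<or> (p = r \<and> q = s) \<or> (p = s \<and> q = r)"
proof (cases "p = q")
  case True
  then show ?thesis using assms[of r] by (cases "r = s"; cases "p = r") simp_all
next
  case False
  have "p = r \<or> p = s" using assms[of p] False by (cases "p = r"; cases "p = s") simp_all
  then show ?thesis using assms[of p] assms[of q] False
    by (cases "p = r"; cases "p = s"; cases "q = r"; cases "q = s") simp_all
qed

lemma even_iff_configuration:
  assumes "ribbon_graph G" "\<phi> \<in> medial_edges G \<rightarrow>\<^sub>E T" "e \<in> edges G"
  shows "(\<forall>i\<in>T. even (card {c \<in> corners_of e. half_edge_colour G \<phi> c = i})) \<longleftrightarrow>
    total_at G \<phi> e \<or> white_at G \<phi> e \<or> black_at G \<phi> e \<or> crossing_at G \<phi> e"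
proof -
  define p q r s where
    "p = half_edge_colour G \<phi> (e, False, False)" and "q = half_edge_colour G \<phi> (e, False, True)" and
    "r = half_edge_colour G \<phi> (e, True, False)" and "s = half_edge_colour G \<phi> (e, True, True)"
  note pqrs = this
  have T: "p \<in> T" "q \<in> T" "r \<in> T" "s \<in> T"
    unfolding pqrs by (intro half_edge_colour_in[OF assms(1,2)]; use assms(3) in simp)+
  have "card {c \<in> corners_of e. half_edge_colour G \<phi> c = i} =
      of_bool (p = i) + of_bool (q = i) + of_bool (r = i) + of_bool (s = i)" for i
  proof -
    have "card {c \<in> corners_of e. half_edge_colour G \<phi> c = i} =
        (\<Sum>c\<in>corners_of e. of_bool (half_edge_colour G \<phi> c = i))"
      unfolding card_eq_sum of_bool_def
      by (rule sum.inter_filter) (simp add: corners_of_explicit)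
    also have "\<dots> = of_bool (p = i) + of_bool (q = i) + of_bool (r = i) + of_bool (s = i)"
      by (simp add: corners_of_explicit pqrs)
    finally show ?thesis .
  qed
  note count = this
  have "(p = q \<and> r = s) \<or> (p = r \<and> q = s) \<or> (p = s \<and> q = r)"
    if "\<forall>i\<in>T. even (card {c \<in> corners_of e. half_edge_colour G \<phi> c = i})"
  proof -
    have "even (of_bool (p = i) + of_bool (q = i) + of_bool (r = i) + of_bool (s = i) :: nat)"
      if "i \<in> T" for i
      using \<open>\<forall>i\<in>T. _ i\<close> that unfolding count by blast
    then show ?thesis using T by (intro even_multiplicities_imp_pairing) blast
  qed
  moreover have "even (card {c \<in> corners_of e. half_edge_colour G \<phi> c = i})"
    if "(p = q \<and> r = s) \<or> (p = r \<and> q = s) \<or> (p = s \<and> q = r)" for i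
    unfolding count using that by (elim disjE conjE) simp_all
  moreover have "(p = q \<and> r = s) \<or> (p = r \<and> q = s) \<or> (p = s \<and> q = r) \<longleftrightarrow>
      total_at G \<phi> e \<or> white_at G \<phi> e \<or> black_at G \<phi> e \<or> crossing_at G \<phi> e"
    unfolding configuration_iff pqrs[symmetric] by auto
  ultimately show ?thesis by blast
qed

lemma prod_if_zero:
  fixes f :: "'b \<Rightarrow> 'c::comm_semiring_1"
  assumes "finite A"
  shows "(\<Prod>x\<in>A. if P x then f x else 0) = (if \<forall>x\<in>A. P x then \<Prod>x\<in>A. f x else 0)"
  using assms by (induction A rule: finite_induct) auto

lemma power_card_filter:
  "finite A \<Longrightarrow> (x :: 'c::comm_monoid_mult) ^ card {e \<in> A. P e} = (\<Prod>e\<in>A. if P e then x else 1)"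
  by (simp add: prod.If_cases Int_def)

text \<open>
  The weight of a configuration is the sum of the weights of the choices compatible with it, and that
  sum is \<open>0\<close> at a vertex violating the parity condition.  So the sum over valuations may be extended to
  all colourings of the medial graph.  Expanding the product over the edges and exchanging the two
  sums, one counts for each state the colourings constant along its curves.
\<close>

lemma Omega_k_eq_state_sum:
  fixes G :: "'e ribbon_graph" and w x y z :: "'a::comm_ring_1"
  assumes G: "ribbon_graph G"
  shows "Omega_k k G w x y z =
    state_sum (case_indet (w - x - y - z) x y z (of_nat k)) (ep_of_ribbon_graph G)"
proof -
  let ?a = "case_indet (w - x - y - z) x y z (of_nat k)"
  let ?H = "ep_of_ribbon_graph G"
  let ?E = "edges G"
  let ?M = "medial_edges G \<rightarrow>\<^sub>E {1..k}"
  have fin: "finite ?E" using G by (simp add: ribbon_graph_def)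
  have finM: "finite ?M" using finite_medial_edges[OF G] by (intro finite_PiE) auto
  have H: "light ?H = ?E" "corners ?H = corners G" "arcs ?H = arcs G" "isolated ?H = isolated G"
    "dark ?H = {}"
    by (simp_all add: ep_of_ribbon_graph_def light_def corners_def)
  let ?weight = "\<lambda>\<phi> e. (if total_at G \<phi> e then w else 1) * (if white_at G \<phi> e then x else 1) *
      (if black_at G \<phi> e then y else 1) * (if crossing_at G \<phi> e then z else 1)"
  let ?local = "\<lambda>\<phi> e. \<Sum>s\<in>smoothings. if compatible G \<phi> e s then ?a s else 0"
  let ?conf = "\<lambda>\<phi> e. total_at G \<phi> e \<or> white_at G \<phi> e \<or> black_at G \<phi> e \<or> crossing_at G \<phi> e"
  \<comment> \<open>For a total configuration the identity reads \<open>(w - x - y - z) + x + y + z = w\<close>.\<close>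
  have local: "?local \<phi> e = (if ?conf \<phi> e then ?weight \<phi> e else 0)" for \<phi> e
    using configurations_exclusive[of G \<phi> e] by (auto simp: compatible_iff)
  have val: "valuations k G = {\<phi> \<in> ?M. \<forall>e\<in>?E. ?conf \<phi> e}"
    unfolding valuations_def using even_iff_configuration[OF G] by blast
  have "Omega_k k G w x y z = (\<Sum>\<phi>\<in>valuations k G. \<Prod>e\<in>?E. ?weight \<phi> e)"
    unfolding Omega_k_def power_card_filter[OF fin] by (simp only: prod.distrib)
  also have "\<dots> = (\<Sum>\<phi>\<in>?M. if \<forall>e\<in>?E. ?conf \<phi> e then \<Prod>e\<in>?E. ?weight \<phi> e else 0)"
    unfolding val by (rule sum.inter_filter[OF finM])
  also have "\<dots> = (\<Sum>\<phi>\<in>?M. \<Prod>e\<in>?E. ?local \<phi> e)"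
    unfolding local prod_if_zero[OF fin] ..
  also have "\<dots> = (\<Sum>\<phi>\<in>?M. \<Sum>\<sigma>\<in>?E \<rightarrow>\<^sub>E smoothings.
      \<Prod>e\<in>?E. if compatible G \<phi> e (\<sigma> e) then ?a (\<sigma> e) else 0)"
    by (intro sum.cong refl prod_sum_PiE fin) simp
  also have "\<dots> = (\<Sum>\<sigma>\<in>?E \<rightarrow>\<^sub>E smoothings. \<Sum>\<phi>\<in>?M.
      if \<forall>e\<in>?E. compatible G \<phi> e (\<sigma> e) then \<Prod>e\<in>?E. ?a (\<sigma> e) else 0)"
    unfolding prod_if_zero[OF fin] by (rule sum.swap)
  also have "\<dots> = (\<Sum>\<sigma>\<in>?E \<rightarrow>\<^sub>E smoothings. (\<Prod>e\<in>?E. ?a (\<sigma> e)) * ?a It ^ loops ?H \<sigma>)"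
  proof (rule sum.cong[OF refl])
    fix \<sigma>
    let ?Q = "\<Union>e\<in>?E. smoothing e (\<sigma> e)"
    have Q: "p \<subseteq> corners G" if p: "p \<in> ?Q" for p
    proof -
      obtain e where "e \<in> ?E" "p \<in> smoothing e (\<sigma> e)" using p by blast
      then show ?thesis using smoothing_subset[of p e "\<sigma> e"] by auto
    qed
    have "{\<phi> \<in> ?M. \<forall>e\<in>?E. compatible G \<phi> e (\<sigma> e)} = {\<phi> \<in> ?M.
        \<forall>p\<in>?Q. \<forall>c\<in>p. \<forall>d\<in>p. half_edge_colour G \<phi> c = half_edge_colour G \<phi> d}"
      unfolding compatible_def by auto
    then have "card {\<phi> \<in> ?M. \<forall>e\<in>?E. compatible G \<phi> e (\<sigma> e)} = k ^ loops ?H \<sigma>"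
      using card_constant_medial_colourings[of G ?Q "{1..k}", OF G Q]
      by (simp add: loops_def smoothed_def H)
    then show "(\<Sum>\<phi>\<in>?M. if \<forall>e\<in>?E. compatible G \<phi> e (\<sigma> e) then \<Prod>e\<in>?E. ?a (\<sigma> e) else 0) =
        (\<Prod>e\<in>?E. ?a (\<sigma> e)) * ?a It ^ loops ?H \<sigma>"
      unfolding sum.inter_filter[OF finM, symmetric] by (simp add: mult.commute)
  qed
  finally show ?thesis by (simp only: state_sum_def H)
qed

theorem corollary4p3:
  fixes G :: "'e ribbon_graph" and w x y z :: "'a::comm_ring_1"
  assumes "ribbon_graph G"
  shows "(\<forall>k. Omega_k k G w x y z =
              Omega_at (ep_of_ribbon_graph G) (w - x - y - z) x y z (of_nat k))
       \<and> (\<exists>p :: 'a poly. \<forall>k. Omega_k k G w x y z = poly p (of_nat k))"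
proof (intro conjI allI)
  let ?H = "ep_of_ribbon_graph G"
  have "ep_ribbon_graph ?H"
    using assms by (simp add: ep_ribbon_graph_def ep_of_ribbon_graph_def ribbon_graph_def corners_def)
  then show "Omega_k k G w x y z = Omega_at ?H (w - x - y - z) x y z (of_nat k)" for k
    by (simp add: Omega_k_eq_state_sum[OF assms] Omega_at_def eval_Omega)
  \<comment> \<open>No state takes the value \<open>It\<close>, so the coefficient \<open>0\<close> put there, instead of \<open>k\<close>, makes the
    polynomial independent of \<open>k\<close>.\<close>
  let ?p = "\<Sum>\<sigma>\<in>light ?H \<rightarrow>\<^sub>E smoothings.
    monom (\<Prod>e\<in>light ?H. case_indet (w - x - y - z) x y z 0 (\<sigma> e)) (loops ?H \<sigma>)"
  have "Omega_k k G w x y z = poly ?p (of_nat k)" for k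
  proof -
    have "(\<Prod>e\<in>light ?H. case_indet (w - x - y - z) x y z (of_nat k) (\<sigma> e)) =
        (\<Prod>e\<in>light ?H. case_indet (w - x - y - z) x y z 0 (\<sigma> e))"
      if "\<sigma> \<in> light ?H \<rightarrow>\<^sub>E smoothings" for \<sigma>
    proof (rule prod.cong[OF refl])
      fix e assume "e \<in> light ?H"
      then have "\<sigma> e \<in> smoothings" by (rule PiE_mem[OF that])
      then show "case_indet (w - x - y - z) x y z (of_nat k) (\<sigma> e) =
          case_indet (w - x - y - z) x y z 0 (\<sigma> e)" by auto
    qed
    then show ?thesis
      by (simp add: Omega_k_eq_state_sum[OF assms] state_sum_def poly_sum poly_monom cong: sum.cong)
  qed
  then show "\<exists>p :: 'a poly. \<forall>k. Omega_k k G w x y z = poly p (of_nat k)" by blast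
qed

end
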